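(* Let $A$ be a finite-dimensional real associative algebra with unit, $S=\{a\in A:a^2=-1\}$ with its complex structure $J_S$, and $K\subseteq S$ a compact complex subvariety. Let $\mathcal U\subseteq\mathbb C$ be an open set invariant under complex conjugation, let $F:\mathcal U\to\mathbb C\otimes A$ be a holomorphic stem function, and let $f:\pi(\mathcal U\times S)\to A$ be the slice-regular function induced by $F$. Define $$\mathcal C_{F,K}=\{(z,s)\in\mathcal U\times K:\ \pi(F(z),s)=0\},\qquad Z_K=\{w\in\mathbb C\otimes A:\ \pi(w,s)=0\text{ for some }s\in K\}.$$ Then: (1) $\mathcal C_{F,K}$ is a complex analytic subset of $\mathcal U\times K$; (2) the projection $\mathrm{pr}_1:\mathcal C_{F,K}\to\mathcal U$ is proper, and its image is the analytic subset $F^{-1}(Z_K)$ of $\mathcal U$; (3) the set $\pi(\mathcal C_{F,K})\subseteq\pi(\mathcal U\times K)$ is exactly the zero set of $f$ restricted to $\pi(\mathcal U\times K)$.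
   Context: The tensor product $\mathbb C\otimes A$ is over $\mathbb R$, with complex structure and conjugation coming from the factor $\mathbb C$. The set $S$ is a smooth embedded submanifold of $A$ with $T_sS=\{h\in A: sh+hs=0\}$, and $J_S(h)=sh$ for $h\in T_sS$ is an integrable complex structure; $S$ is regarded as a complex manifold in this way. Two maps are denoted $\pi$: $\pi:\mathbb C\times S\to A$, $\pi(x+iy,s)=x+sy$, and its extension $\pi:\mathbb C\otimes A\times S\to A$, $\pi(1\otimes a+i\otimes b,s)=a+sb$. A holomorphic stem function is a holomorphic map $F:\mathcal U\to\mathbb C\otimes A$ with $F(\bar z)=\overline{F(z)}$; the slice-regular function induced by $F$ is the well-defined function $f$ on $\pi(\mathcal U\times S)$ with $f(\pi(z,s))=\pi(F(z),s)$. "Complex subvariety" means closed complex analytic subset. *)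

theory Defs
  imports "HOL-Analysis.Analysis"
begin

section \<open>Complex manifolds embedded in Euclidean space\<close>

text \<open>
  A complex manifold is presented as a smooth embedded submanifold \<open>points\<close> of a
  Euclidean space, with its tangent space at each point (as a subspace of the ambient space)
  and its complex structure on each tangent space.  The record carries no axioms: only the
  instances below, which are complex manifolds, are used.  Values of \<open>tangent\<close> and
  \<open>cstr\<close> away from \<open>points\<close> (resp. the tangent spaces) are irrelevant.
\<close>

record 'e cmanifold =
  points :: "'e set"
  tangent :: "'e \<Rightarrow> 'e set"
  cstr :: "'e \<Rightarrow> 'e \<Rightarrow> 'e"

definition prod_cmanifold ::
    "'e cmanifold \<Rightarrow> 'f cmanifold \<Rightarrow> ('e \<times> 'f) cmanifold" (infixr \<open>\<times>\<^sub>c\<close> 80) where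
  "M \<times>\<^sub>c N =
     \<lparr> points = points M \<times> points N,
       tangent = (\<lambda>(p, q). tangent M p \<times> tangent N q),
       cstr = (\<lambda>(p, q) (h, k). (cstr M p h, cstr N q k)) \<rparr>"

definition plane_domain :: "complex set \<Rightarrow> complex cmanifold" where
  "plane_domain U = \<lparr> points = U, tangent = (\<lambda>_. UNIV), cstr = (\<lambda>_ h. \<i> * h) \<rparr>"

text \<open>
  Holomorphic maps on a relatively open set \<open>V\<close> of \<open>M\<close>: real differentiable at every point,
  with derivative intertwining the complex structures on tangent vectors.  The derivative
  within \<open>V\<close> is determined only on vectors tangent to \<open>M\<close>, and only those are constrained.
  As usual, complex differentiability at every point already implies smoothness.
\<close>

definition holomorphic_map ::
    "'e::euclidean_space cmanifold \<Rightarrow> 'f::euclidean_space cmanifold \<Rightarrow> 'e set \<Rightarrow> ('e \<Rightarrow> 'f) \<Rightarrow> bool"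
  where
  "holomorphic_map M N V f \<longleftrightarrow>
     openin (top_of_set (points M)) V \<and> f ` V \<subseteq> points N \<and>
     (\<forall>p\<in>V. \<exists>D. (f has_derivative D) (at p within V) \<and>
        (\<forall>h\<in>tangent M p. D (cstr M p h) = cstr N (f p) (D h)))"

text \<open>
  \<open>analytic_subset M X Z\<close>: \<open>Z\<close> is a complex analytic subset of \<open>X\<close>, where \<open>X\<close> is either the
  whole manifold \<open>M\<close> or itself an analytic subset of \<open>M\<close> with the induced (reduced) complex
  space structure, whose holomorphic functions are locally restrictions of holomorphic
  functions on \<open>M\<close>.  The local condition is imposed at every point of \<open>X\<close>, not only at the
  points of \<open>Z\<close>, so \<open>Z\<close> is automatically closed in \<open>X\<close>.
\<close>

definition analytic_subset ::
    "'e::euclidean_space cmanifold \<Rightarrow> 'e set \<Rightarrow> 'e set \<Rightarrow> bool" where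
  "analytic_subset M X Z \<longleftrightarrow>
     Z \<subseteq> X \<and> X \<subseteq> points M \<and>
     (\<forall>p\<in>X. \<exists>V G. openin (top_of_set (points M)) V \<and> p \<in> V \<and> finite G \<and>
        (\<forall>g\<in>G. holomorphic_map M (plane_domain UNIV) V g) \<and>
        Z \<inter> V = {q \<in> X \<inter> V. \<forall>g\<in>G. g q = 0})"

section \<open>The imaginary units of a real algebra\<close>

text \<open>
  A finite-dimensional real unital associative algebra is a type of sort
  \<open>{real_algebra_1, euclidean_space}\<close>.  The inner product is auxiliary: no compatibility
  with the multiplication is required, and it only serves to give the algebra its canonical
  topology as a finite-dimensional real vector space.
\<close>

definition units_sphere :: "'a::{real_algebra_1, euclidean_space} set" where
  "units_sphere = {a. a\<^sup>2 = - 1}"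

definition sphere_cmanifold :: "'a::{real_algebra_1, euclidean_space} cmanifold" where
  "sphere_cmanifold =
     \<lparr> points = units_sphere, tangent = (\<lambda>s. {h. s * h + h * s = 0}), cstr = (\<lambda>s h. s * h) \<rparr>"

section \<open>The complexified algebra\<close>

text \<open>
  The real tensor product of the complex numbers with \<open>'a\<close> is realised on \<open>'a \<times> 'a\<close>, the
  pair \<open>(a, b)\<close> being \<open>1 \<otimes> a + \<i> \<otimes> b\<close>.  The lemmas after the definitions identify it, with
  its complex structure and conjugation, by the universal property.
\<close>

type_synonym 'a cplx = "'a \<times> 'a"

definition tensor :: "complex \<Rightarrow> 'a::real_vector \<Rightarrow> 'a cplx" where
  "tensor z a = (Re z *\<^sub>R a, Im z *\<^sub>R a)"

definition cplx_i :: "'a::real_vector cplx \<Rightarrow> 'a cplx" where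
  "cplx_i w = (- snd w, fst w)"

definition cplx_cnj :: "'a::real_vector cplx \<Rightarrow> 'a cplx" where
  "cplx_cnj w = (fst w, - snd w)"

definition cplx_cmanifold :: "'a::euclidean_space cplx cmanifold" where
  "cplx_cmanifold = \<lparr> points = UNIV, tangent = (\<lambda>_. UNIV), cstr = (\<lambda>_. cplx_i) \<rparr>"

lemma cplx_eq_tensor: "(a, b) = tensor 1 a + tensor \<i> b"
  by (simp add: tensor_def)

lemma bilinear_tensor: "bilinear (tensor :: complex \<Rightarrow> 'a::real_vector \<Rightarrow> _)"
  by (auto simp: bilinear_def tensor_def intro!: linearI simp: algebra_simps)

lemma tensor_universal:
  fixes B :: "complex \<Rightarrow> 'a::real_vector \<Rightarrow> 'v::real_vector"
  assumes "bilinear B"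
  shows "\<exists>!L. linear L \<and> (\<forall>z a. L (tensor z a) = B z a)"
proof (rule ex1I)
  let ?L = "\<lambda>w. B 1 (fst w) + B \<i> (snd w)"
  have B: "B (x + y) a = B x a + B y a" "B x (a + b) = B x a + B x b"
    "B (r *\<^sub>R x) a = r *\<^sub>R B x a" "B x (r *\<^sub>R a) = r *\<^sub>R B x a" for x y a b r
    using assms
    by (simp_all add: bilinear_ladd bilinear_radd bilinear_lmul bilinear_rmul)
  have E: "B z a = Re z *\<^sub>R B 1 a + Im z *\<^sub>R B \<i> a" for z a
  proof -
    have "z = Re z *\<^sub>R 1 + Im z *\<^sub>R \<i>"
      by (simp add: complex_eq_iff)
    then show ?thesis
      by (metis B(1,3))
  qed
  have "linear ?L"
    by (rule linearI) (simp_all add: B(2,4) scaleR_add_right add_ac)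
  moreover have "?L (tensor z a) = B z a" for z a
    using E[of z a] by (simp only: tensor_def fst_conv snd_conv B(4))
  ultimately show "linear ?L \<and> (\<forall>z a. ?L (tensor z a) = B z a)"
    by blast
  fix L assume L: "linear L \<and> (\<forall>z a. L (tensor z a) = B z a)"
  show "L = ?L"
  proof
    fix w :: "'a cplx"
    have "w = tensor 1 (fst w) + tensor \<i> (snd w)"
      by (simp add: tensor_def)
    then show "L w = ?L w"
      using L by (metis linear_add)
  qed
qed

lemma cplx_i_tensor: "cplx_i (tensor z a) = tensor (\<i> * z) a"
  by (simp add: cplx_i_def tensor_def)

lemma cplx_cnj_tensor: "cplx_cnj (tensor z a) = tensor (cnj z) a"
  by (simp add: cplx_cnj_def tensor_def)

section \<open>Slice-regular functions\<close>

definition slice_pt :: "complex \<Rightarrow> 'a::real_algebra_1 \<Rightarrow> 'a" where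
  "slice_pt z s = of_real (Re z) + s * of_real (Im z)"

definition slice_val :: "'a::real_algebra_1 cplx \<Rightarrow> 'a \<Rightarrow> 'a" where
  "slice_val w s = fst w + s * snd w"

lemma slice_val_tensor: "slice_val (tensor z 1) s = slice_pt z s"
  by (simp add: slice_val_def slice_pt_def tensor_def of_real_def)

definition holomorphic_stem ::
    "complex set \<Rightarrow> (complex \<Rightarrow> 'a::{real_algebra_1, euclidean_space} cplx) \<Rightarrow> bool" where
  "holomorphic_stem U F \<longleftrightarrow>
     holomorphic_map (plane_domain U) cplx_cmanifold U F \<and>
     (\<forall>z\<in>U. F (cnj z) = cplx_cnj (F z))"

text \<open>
  \<open>f\<close> is the slice-regular function induced by \<open>F\<close>; its values outside
  \<open>\<pi>(U \<times> S)\<close> are unconstrained.  By the lemma below such an \<open>f\<close> always exists, and the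
  condition visibly determines it on \<open>\<pi>(U \<times> S)\<close>.
\<close>

definition slice_induced ::
    "complex set \<Rightarrow> (complex \<Rightarrow> 'a::{real_algebra_1, euclidean_space} cplx) \<Rightarrow> ('a \<Rightarrow> 'a) \<Rightarrow> bool"
  where
  "slice_induced U F f \<longleftrightarrow>
     (\<forall>z\<in>U. \<forall>s\<in>units_sphere. f (slice_pt z s) = slice_val (F z) s)"

lemma slice_pt_eqD:
  fixes s t :: "'a::{real_algebra_1, euclidean_space}"
  assumes s: "s \<in> units_sphere" and t: "t \<in> units_sphere"
    and eq: "slice_pt z s = slice_pt w t"
  shows "w = z \<and> (Im z = 0 \<or> t = s) \<or> w = cnj z \<and> t = - s"
proof -
  have sq: "s * s = - 1" "t * t = - 1"
    using s t by (simp_all add: units_sphere_def power2_eq_square)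
  define c where "c = Re w - Re z"
  have e: "Im z *\<^sub>R s = c *\<^sub>R 1 + Im w *\<^sub>R t"
    using eq by (simp add: slice_pt_def c_def of_real_def algebra_simps)
  have "(Im z *\<^sub>R s) * (Im z *\<^sub>R s) = (c *\<^sub>R 1 + Im w *\<^sub>R t) * (c *\<^sub>R 1 + Im w *\<^sub>R t)"
    by (simp add: e)
  also have "\<dots> = (c * c - Im w * Im w) *\<^sub>R 1 + (2 * c * Im w) *\<^sub>R t"
  proof -
    have d: "(2 * c * Im w) *\<^sub>R t = (c * Im w) *\<^sub>R t + (c * Im w) *\<^sub>R t"
      by (metis mult_2 mult.assoc scaleR_add_left)
    have "(c *\<^sub>R 1 + Im w *\<^sub>R t) * (c *\<^sub>R 1 + Im w *\<^sub>R t)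
        = (c * c) *\<^sub>R 1 + (c * Im w) *\<^sub>R t + (c * Im w) *\<^sub>R t + (Im w * Im w) *\<^sub>R (t * t)"
      by (simp add: distrib_left distrib_right scaleR_add_right add.assoc mult.commute[of "Im w" c])
    then show ?thesis
      by (simp add: sq scaleR_left_diff_distrib d del: scaleR_scaleR)
  qed
  finally have "(- (Im z * Im z)) *\<^sub>R 1 = (c * c - Im w * Im w) *\<^sub>R 1 + (2 * c * Im w) *\<^sub>R t"
    by (simp add: sq)
  then have e2: "(2 * c * Im w) *\<^sub>R t = (- (Im z * Im z) - (c * c - Im w * Im w)) *\<^sub>R 1"
    unfolding scaleR_left_diff_distrib[of "- (Im z * Im z)"] by (simp only: add_diff_cancel_left')
  have *: "x = 0" if "x *\<^sub>R t = y *\<^sub>R 1" for x y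
  proof (rule ccontr)
    assume x: "x \<noteq> 0"
    have "(x *\<^sub>R t) * (x *\<^sub>R t) = (y *\<^sub>R 1) * (y *\<^sub>R (1::'a))"
      using that by simp
    then have "(- (x * x)) *\<^sub>R (1::'a) = (y * y) *\<^sub>R 1"
      by (simp add: sq)
    then have "- (x * x) = y * y"
      by (metis scaleR_right_imp_eq zero_neq_one)
    then show False
      using x by (smt (verit) not_square_less_zero mult_eq_0_iff)
  qed
  from *[OF e2] have "c = 0 \<or> Im w = 0"
    by simp
  then have "c = 0 \<and> Im z * Im z = Im w * Im w"
  proof
    assume "c = 0"
    then show ?thesis
      using e2 by simp
  next
    assume "Im w = 0"
    then have "- (c * c) = Im z * Im z"
      using e2 by simp
    then have "c * c = 0" "Im z * Im z = 0"
      by (smt (verit) zero_le_square)+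
    then show ?thesis
      using \<open>Im w = 0\<close> by simp
  qed
  then have c: "Re w = Re z" and "Im w = Im z \<or> Im w = - Im z"
    by (auto simp: c_def square_eq_iff)
  moreover have "Im z *\<^sub>R s = Im w *\<^sub>R t"
    using e c by (simp add: c_def)
  moreover have "Im z = 0 \<or> t = - s" if "Im z *\<^sub>R s = - (Im z *\<^sub>R t)"
  proof -
    have "Im z *\<^sub>R (s + t) = 0"
      using that by (simp add: scaleR_add_right)
    then show ?thesis
      by (auto simp: eq_neg_iff_add_eq_0 add.commute)
  qed
  ultimately show ?thesis
    by (auto simp: complex_eq_iff)
qed

lemma slice_induced_exists:
  assumes "holomorphic_stem U F"
  shows "\<exists>f. slice_induced U F f"
proof -
  have wd: "slice_val (F z) s = slice_val (F w) t"
    if z: "z \<in> U" and w: "w \<in> U" and st: "s \<in> units_sphere" "t \<in> units_sphere"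
      and eq: "slice_pt z s = slice_pt w t" for z w s t
  proof -
    have stem: "F (cnj z) = cplx_cnj (F z)"
      using assms z by (simp add: holomorphic_stem_def)
    have "snd (F z) = 0" if "Im z = 0"
    proof -
      have "cnj z = z"
        using that by (simp add: complex_eq_iff)
      with stem have "snd (F z) = - snd (F z)"
        by (metis cplx_cnj_def snd_conv)
      then have "2 *\<^sub>R snd (F z) = 0"
        by (metis add.right_inverse scaleR_2)
      then show ?thesis
        by simp
    qed
    then show ?thesis
      using slice_pt_eqD[OF st eq] stem
      by (auto simp: slice_val_def cplx_cnj_def)
  qed
  define f where "f = (\<lambda>x. THE y. \<exists>z\<in>U. \<exists>s\<in>units_sphere. x = slice_pt z s \<and> y = slice_val (F z) s)"
  have "f (slice_pt z s) = slice_val (F z) s" if "z \<in> U" "s \<in> units_sphere" for z s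
    unfolding f_def
  proof (rule the_equality)
    show "\<exists>z'\<in>U. \<exists>s'\<in>units_sphere. slice_pt z s = slice_pt z' s' \<and> slice_val (F z) s = slice_val (F z') s'"
      using that by blast
    fix y
    assume "\<exists>z'\<in>U. \<exists>s'\<in>units_sphere. slice_pt z s = slice_pt z' s' \<and> y = slice_val (F z') s'"
    then obtain z' s' where "z' \<in> U" "s' \<in> units_sphere" "slice_pt z s = slice_pt z' s'"
      "y = slice_val (F z') s'"
      by blast
    then show "y = slice_val (F z) s"
      using wd[of z z' s s'] that by simp
  qed
  then show ?thesis
    by (auto simp: slice_induced_def)
qed

section \<open>Zeros along a subvariety of units\<close>

definition zero_locus ::
    "complex set \<Rightarrow> (complex \<Rightarrow> 'a::real_algebra_1 cplx) \<Rightarrow> 'a set \<Rightarrow> (complex \<times> 'a) set" where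
  "zero_locus U F K = {(z, s). z \<in> U \<and> s \<in> K \<and> slice_val (F z) s = 0}"

definition zero_cone :: "'a::real_algebra_1 set \<Rightarrow> 'a cplx set" where
  "zero_cone K = {w. \<exists>s\<in>K. slice_val w s = 0}"

end

theory Submission
  imports Defs "HOL-Complex_Analysis.Complex_Analysis"
begin

text \<open>
  Left multiplication by a unit \<open>s\<close> makes the algebra a complex vector space, and these spaces
  form a holomorphic bundle over the units, of which \<open>(z, s) \<mapsto> \<pi>(F(z), s)\<close> is a holomorphic
  section.  Hence its zero set over \<open>U \<times> K\<close> is analytic, and it is proper over \<open>U\<close> because \<open>K\<close> is
  compact.

  For the image in \<open>U\<close> it suffices that it contains a neighbourhood of each point \<open>z0 \<in> U\<close> at
  which it accumulates.  By compactness there are then zeros \<open>(z, s)\<close> with \<open>z \<noteq> z0\<close> arbitrarily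
  close to some \<open>(z0, s0)\<close>.  In the chart \<open>x \<mapsto> (1 - x)\<^sup>-\<^sup>1 s0 (1 - x)\<close> near \<open>s0\<close> the statement is a
  local one about common zeros of holomorphic functions of several variables, proved by
  eliminating one variable at a time: the zero set is projected along a direction in which one
  of the equations has isolated zeros, and the image is cut out by products over these zeros.
\<close>

section \<open>Holomorphic functions on real spaces with a complex structure\<close>

text \<open>The image in \<open>U\<close> is a case of Remmert's proper mapping theorem, and a
  target of dimension one reduces it to a dichotomy. Near a point of \<open>U\<close> the image is
  either at most that point, cut out by \<open>w - z\<close> or by a nonzero constant, or, once it
  accumulates there, a full disc, which needs no equation. The local part does without dimension
  theory and irreducible components. A function of several variables counts as holomorphic if it is
  continuous and holomorphic along complex lines. So every argument concerns one variable with
  parameters, and derivatives, quotients and power sums are all Cauchy integrals over a circle.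
  Variables are eliminated without coordinates: the domains lie in complex subspaces
  \<open>W\<close> of one fixed space, and elimination passes to a smaller subspace. One norm per
  given equation would only say that each equation vanishes at some zero of \<open>f\<close> in the
  fibre, possibly at different ones. Hence the norms of all holomorphic functions vanishing on the
  common zero set are used, and the local statement has to allow infinite families of
  equations.\<close>

locale complex_structure =
  fixes J :: "'v::euclidean_space \<Rightarrow> 'v"
  assumes linear_J: "linear J" and J_J: "J (J x) = - x"
begin

definition cscale :: "complex \<Rightarrow> 'v \<Rightarrow> 'v"  (infixr \<open>\<bullet>\<^sub>c\<close> 75) where
  "c \<bullet>\<^sub>c x = Re c *\<^sub>R x + Im c *\<^sub>R J x"

definition csubspace :: "'v set \<Rightarrow> bool" where
  "csubspace W \<longleftrightarrow> subspace W \<and> J ` W \<subseteq> W"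

definition clinear :: "('v \<Rightarrow> complex) \<Rightarrow> bool" where
  "clinear l \<longleftrightarrow> linear l \<and> (\<forall>x. l (J x) = \<i> * l x)"

text \<open>
  Here \<open>D\<close> is meant to be a relatively open subset of a complex subspace \<open>W\<close>; the
  vectors of \<open>W\<close> are the admissible directions.
\<close>

definition hol :: "'v set \<Rightarrow> 'v set \<Rightarrow> ('v \<Rightarrow> complex) \<Rightarrow> bool" where
  "hol W D f \<longleftrightarrow> continuous_on D f \<and>
     (\<forall>p\<in>D. \<forall>q\<in>W. (\<lambda>t. f (p + t \<bullet>\<^sub>c q)) field_differentiable at 0)"

lemma J_simps [simp]: "J (x + y) = J x + J y" "J (x - y) = J x - J y" "J (- x) = - J x"
    "J (r *\<^sub>R x) = r *\<^sub>R J x" "J 0 = 0" "J (J x) = - x"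
  using linear_J J_J
  by (simp_all add: linear_add linear_diff linear_neg linear_scale linear_0)

lemma cscale_simps [simp]: "1 \<bullet>\<^sub>c x = x" "0 \<bullet>\<^sub>c x = 0" "c \<bullet>\<^sub>c 0 = 0" "\<i> \<bullet>\<^sub>c x = J x"
  by (simp_all add: cscale_def)

lemma cscale_add_left: "(c + d) \<bullet>\<^sub>c x = c \<bullet>\<^sub>c x + d \<bullet>\<^sub>c x"
  and cscale_diff_left: "(c - d) \<bullet>\<^sub>c x = c \<bullet>\<^sub>c x - d \<bullet>\<^sub>c x"
  by (simp_all add: cscale_def algebra_simps)

lemma bounded_bilinear_cscale: "bounded_bilinear (\<bullet>\<^sub>c)"
proof -
  have "bilinear (\<bullet>\<^sub>c)"
    unfolding bilinear_def by (auto intro!: linearI simp: cscale_def algebra_simps)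
  then show ?thesis
    by (simp add: bilinear_conv_bounded_bilinear)
qed

lemmas continuous_on_cscale [continuous_intros] =
  bounded_bilinear.continuous_on[OF bounded_bilinear_cscale]

lemmas tendsto_cscale [tendsto_intros] =
  bounded_bilinear.tendsto[OF bounded_bilinear_cscale]

lemma csubspaceD:
  assumes "csubspace W"
  shows "subspace W" "x \<in> W \<Longrightarrow> c \<bullet>\<^sub>c x \<in> W" "x \<in> W \<Longrightarrow> y \<in> W \<Longrightarrow> x + y \<in> W"
    "x \<in> W \<Longrightarrow> y \<in> W \<Longrightarrow> x - y \<in> W" "0 \<in> W"
  using assms unfolding csubspace_def cscale_def
  by (auto intro!: subspace_add subspace_scale subspace_diff subspace_0)

lemma clinearD:
  assumes "clinear l"
  shows "linear l" "l (c \<bullet>\<^sub>c x) = c * l x" "l (x + y) = l x + l y" "l (x - y) = l x - l y" "l 0 = 0"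
    "continuous_on D l"
proof -
  show l: "linear l" using assms by (simp add: clinear_def)
  show "l (c \<bullet>\<^sub>c x) = c * l x"
    using assms by (simp add: clinear_def cscale_def linear_add[OF l] linear_scale[OF l] 
      complex_eq_iff)
  show "l (x + y) = l x + l y" "l (x - y) = l x - l y" "l 0 = 0"
    using l by (simp_all add: linear_add linear_diff linear_0)
  show "continuous_on D l" using l by (rule linear_continuous_on[OF linear_conv_bounded_linear[THEN iffD1]])
qed

lemma clinear_dual_exists:
  assumes "v \<noteq> 0"
  obtains l where "clinear l" "l v = 1"
proof -
  \<comment> \<open>The complex linear functional with real part \<open>x \<bullet> v\<close>. At
    \<open>v\<close> its real part is positive; \<open>J\<close> need not be orthogonal, so
    \<open>m v\<close> may have an imaginary part, and \<open>m\<close> is normalised by dividing by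
    the complex number \<open>m v\<close>.\<close>
  define m where "m x = complex_of_real (x \<bullet> v) - \<i> * complex_of_real (J x \<bullet> v)" for x
  have "linear m"
    by (rule linearI) (auto simp: m_def inner_add_left algebra_simps scaleR_conv_of_real)
  have mJ: "m (J x) = \<i> * m x" for x
    by (simp add: m_def algebra_simps complex_eq_iff)
  have "m v \<noteq> 0"
    using assms by (auto simp: m_def complex_eq_iff)
  define l where "l x = m x / m v" for x
  have "linear l"
    using \<open>linear m\<close> unfolding l_def
    by (intro linearI) (simp_all add: linear_add linear_scale add_divide_distrib scaleR_conv_of_real)
  then have "clinear l"
    by (simp add: clinear_def l_def mJ)
  moreover have "l v = 1"
    using \<open>m v \<noteq> 0\<close> by (simp add: l_def)
  ultimately show thesis ..
qed

lemma holD: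
  assumes "hol W D f"
  shows "continuous_on D f" "p \<in> D \<Longrightarrow> q \<in> W \<Longrightarrow> (\<lambda>t. f (p + t \<bullet>\<^sub>c q)) field_differentiable at 0"
  using assms by (auto simp: hol_def)

lemma hol_mono: "hol W D f \<Longrightarrow> W' \<subseteq> W \<Longrightarrow> D' \<subseteq> D \<Longrightarrow> hol W' D' f"
  by (auto simp: hol_def intro: continuous_on_subset)

lemma hol_const [simp]: "hol W D (\<lambda>_. c)"
  by (auto simp: hol_def)

lemma hol_add: "hol W D f \<Longrightarrow> hol W D g \<Longrightarrow> hol W D (\<lambda>p. f p + g p)"
  and hol_mult: "hol W D f \<Longrightarrow> hol W D g \<Longrightarrow> hol W D (\<lambda>p. f p * g p)"
  by (auto simp: hol_def intro!: continuous_intros derivative_intros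
      field_differentiable_add field_differentiable_mult)

lemma hol_sum: "(\<And>i. i \<in> I \<Longrightarrow> hol W D (f i)) \<Longrightarrow> hol W D (\<lambda>p. \<Sum>i\<in>I. f i p)"
  by (induction I rule: infinite_finite_induct) (auto intro: hol_add)

lemma hol_power: "hol W D f \<Longrightarrow> hol W D (\<lambda>p. f p ^ n)"
  by (induction n) (auto intro: hol_mult)

lemma hol_divide:
  assumes "hol W D f" "hol W D g" "\<And>p. p \<in> D \<Longrightarrow> g p \<noteq> 0"
  shows "hol W D (\<lambda>p. f p / g p)"
  using assms by (auto simp: hol_def intro!: continuous_intros field_differentiable_divide)

lemma hol_clinear: "clinear l \<Longrightarrow> hol W D l"
  by (auto simp: hol_def clinearD intro!: derivative_intros field_differentiable_add field_differentiable_mult)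

lemma hol_shift:
  assumes "hol W D f" "\<And>p. p \<in> D' \<Longrightarrow> p + a \<in> D"
  shows "hol W D' (\<lambda>p. f (p + a))"
  unfolding hol_def
proof (intro conjI ballI)
  show "continuous_on D' (\<lambda>p. f (p + a))"
    by (rule continuous_on_compose2[OF holD(1)[OF assms(1)]]) (use assms(2) in \<open>auto intro!: continuous_intros\<close>)
  fix p q assume "p \<in> D'" "q \<in> W"
  then have "(\<lambda>t. f ((p + a) + t \<bullet>\<^sub>c q)) field_differentiable at 0"
    using assms by (intro holD(2)) auto
  moreover have "(p + a) + t \<bullet>\<^sub>c q = p + t \<bullet>\<^sub>c q + a" for t
    by (simp add: add_ac)
  ultimately show "(\<lambda>t. f (p + t \<bullet>\<^sub>c q + a)) field_differentiable at 0"
    by simp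
qed

text \<open>\<open>hol\<close> speaks only of the parameter 0, but at every base point; moving the
  base point along the line reaches every other parameter.\<close>

lemma hol_line:
  assumes "hol W D f" "q \<in> W" "\<And>t. t \<in> T \<Longrightarrow> p + t \<bullet>\<^sub>c q \<in> D"
  shows "(\<lambda>t. f (p + t \<bullet>\<^sub>c q)) holomorphic_on T"
  unfolding holomorphic_on_def
proof
  fix t assume "t \<in> T"
  then have "(\<lambda>s. f ((p + t \<bullet>\<^sub>c q) + s \<bullet>\<^sub>c q)) field_differentiable at 0"
    using assms by (intro holD(2)) auto
  then obtain d where "((\<lambda>s. f ((p + t \<bullet>\<^sub>c q) + s \<bullet>\<^sub>c q)) has_field_derivative d) (at 0)"
    by (auto simp: field_differentiable_def)
  then have "((\<lambda>s. f (p + (s + t) \<bullet>\<^sub>c q)) has_field_derivative d) (at 0)"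
    by (simp add: cscale_add_left add_ac)
  then have "((\<lambda>s. f (p + s \<bullet>\<^sub>c q)) has_field_derivative d) (at t)"
    using DERIV_shift[of "\<lambda>s. f (p + s \<bullet>\<^sub>c q)" d 0 t] by simp
  then show "(\<lambda>t. f (p + t \<bullet>\<^sub>c q)) field_differentiable at t within T"
    using field_differentiable_at_within field_differentiable_def by blast
qed

lemma eventually_line_in:
  assumes "csubspace W" "openin (top_of_set W) D" "p \<in> D" "q \<in> W"
  shows "\<forall>\<^sub>F t in nhds 0. p + t \<bullet>\<^sub>c q \<in> D"
proof -
  obtain O' where O': "open O'" "D = W \<inter> O'"
    using assms(2) by (auto simp: openin_open)
  have "((\<lambda>t. p + t \<bullet>\<^sub>c q) \<longlongrightarrow> p + 0 \<bullet>\<^sub>c q) (nhds 0)"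
    by (intro tendsto_intros filterlim_ident)
  then have "\<forall>\<^sub>F t in nhds 0. p + t \<bullet>\<^sub>c q \<in> O'"
    using O' assms(3) by (intro topological_tendstoD) auto
  then show ?thesis
    by (rule eventually_mono) (use O' assms in \<open>auto intro: csubspaceD\<close>)
qed

lemma hol_local:
  assumes "csubspace W" "openin (top_of_set W) D"
    and loc: "\<And>p. p \<in> D \<Longrightarrow> \<exists>e>0. \<exists>g. hol W (D \<inter> ball p e) g \<and> (\<forall>x\<in>D \<inter> ball p e. f x = g x)"
  shows "hol W D f"
  unfolding hol_def
proof (intro conjI ballI)
  show "continuous_on D f"
    unfolding continuous_on_eq_continuous_within
  proof
    fix p assume p: "p \<in> D"
    obtain e g where e: "e > 0" "hol W (D \<inter> ball p e) g" "\<forall>x\<in>D \<inter> ball p e. f x = g x"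
      using loc[OF p] by blast
    then have "continuous_on (D \<inter> ball p e) f"
      using continuous_on_cong holD(1) by (metis (mono_tags, lifting))
    then have "continuous (at p within (D \<inter> ball p e)) f"
      using p e(1) by (simp add: continuous_on_eq_continuous_within)
    then show "continuous (at p within D) f"
      using at_within_nhd[of p "ball p e" "D \<inter> ball p e" D] e(1) by (auto simp: Int_assoc)
  qed
  fix p q assume p: "p \<in> D" and q: "q \<in> W"
  obtain e g where e: "e > 0" "hol W (D \<inter> ball p e) g" "\<forall>x\<in>D \<inter> ball p e. f x = g x"
    using loc[OF p] by blast
  have "openin (top_of_set W) (D \<inter> ball p e)"
    using assms(2) by (simp add: openin_Int_open)
  then have ev: "\<forall>\<^sub>F t in nhds 0. p + t \<bullet>\<^sub>c q \<in> D \<inter> ball p e"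
    using p q e(1) assms(1) by (intro eventually_line_in) auto
  have "(\<lambda>t. g (p + t \<bullet>\<^sub>c q)) field_differentiable at 0"
    using p q e(1) by (intro holD(2)[OF e(2)]) auto
  then obtain d where d: "((\<lambda>t. g (p + t \<bullet>\<^sub>c q)) has_field_derivative d) (at 0)"
    by (auto simp: field_differentiable_def)
  have "\<forall>\<^sub>F t in nhds 0. g (p + t \<bullet>\<^sub>c q) = f (p + t \<bullet>\<^sub>c q)"
    using ev by (rule eventually_mono) (simp add: e(3))
  then have "((\<lambda>t. f (p + t \<bullet>\<^sub>c q)) has_field_derivative d) (at 0)"
    by (rule DERIV_cong_ev[OF refl _ refl, THEN iffD1, OF _ d])
  then show "(\<lambda>t. f (p + t \<bullet>\<^sub>c q)) field_differentiable at 0"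
    by (auto simp: field_differentiable_def)
qed

end

section \<open>Circle integrals depending on a parameter\<close>

lemma continuous_on_contour_integral_param:
  fixes \<Phi> :: "'b::topological_space \<Rightarrow> complex \<Rightarrow> complex"
  assumes "0 \<le> \<rho>" and c: "continuous_on (D \<times> sphere 0 \<rho>) (\<lambda>(p, \<xi>). \<Phi> p \<xi>)"
  shows "continuous_on D (\<lambda>p. contour_integral (circlepath 0 \<rho>) (\<Phi> p))"
proof -
  have "continuous_on D (\<lambda>p. integral (cbox 0 (1::real))
      (\<lambda>t. \<Phi> p (circlepath 0 \<rho> t) * vector_derivative (circlepath 0 \<rho>) (at t)))"
  proof (rule integral_continuous_on_param)
    have "continuous_on (D \<times> cbox 0 1) (\<lambda>x. (\<lambda>(p, \<xi>). \<Phi> p \<xi>) (fst x, circlepath 0 \<rho> (snd x)))"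
      by (rule continuous_on_compose2[OF c])
        (use \<open>0 \<le> \<rho>\<close> in \<open>auto intro!: continuous_intros simp: circlepath_def part_circlepath_def
           linepath_def norm_mult\<close>)
    then show "continuous_on (D \<times> cbox 0 1)
       (\<lambda>(x, t). \<Phi> x (circlepath 0 \<rho> t) * vector_derivative (circlepath 0 \<rho>) (at t))"
      unfolding vector_derivative_circlepath split_def
      by (intro continuous_intros) auto
  qed
  then show ?thesis
    by (simp add: contour_integral_integral)
qed

text \<open>Morera: the integral over a triangle is exchanged with the one over the circle, and the
  inner integral vanishes by Cauchy's theorem for triangles. The continuity shown in
  \<open>int\<close> makes the exchanged integrals add up.\<close>

lemma holomorphic_contour_integral_param:
  fixes \<Phi> :: "complex \<Rightarrow> complex \<Rightarrow> complex"
  assumes "0 \<le> \<rho>" "open T" and c: "continuous_on (T \<times> sphere 0 \<rho>) (\<lambda>(p, \<xi>). \<Phi> p \<xi>)"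
    and h: "\<And>\<xi>. \<xi> \<in> sphere 0 \<rho> \<Longrightarrow> (\<lambda>t. \<Phi> t \<xi>) holomorphic_on T"
  shows "(\<lambda>t. contour_integral (circlepath 0 \<rho>) (\<Phi> t)) holomorphic_on T"
proof -
  let ?g = "circlepath 0 \<rho>"
  let ?I = "\<lambda>t. contour_integral ?g (\<Phi> t)"
  have ci: "continuous_on T ?I"
    using assms by (intro continuous_on_contour_integral_param) auto
  have pg: "path_image ?g = sphere 0 \<rho>"
    using \<open>0 \<le> \<rho>\<close> by simp
  have sw: "contour_integral (linepath a b) ?I = 
      contour_integral ?g (\<lambda>\<xi>. contour_integral (linepath a b) (\<lambda>t. \<Phi> t \<xi>))"
    if "closed_segment a b \<subseteq> T" for a b
  proof (rule contour_integral_swap)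
    show "continuous_on (path_image (linepath a b) \<times> path_image ?g) (\<lambda>(y1, y2). \<Phi> y1 y2)"
      by (rule continuous_on_subset[OF c]) (use that pg in auto)
    show "continuous_on {0..1} (\<lambda>t. vector_derivative (linepath a b) (at t))"
      by simp
    show "continuous_on {0..1} (\<lambda>t. vector_derivative ?g (at t))"
      unfolding vector_derivative_circlepath by (intro continuous_intros)
  qed auto
  have int: "(\<lambda>\<xi>. contour_integral (linepath a b) (\<lambda>t. \<Phi> t \<xi>)) contour_integrable_on ?g"
    if ab: "closed_segment a b \<subseteq> T" for a b
  proof -
    have "continuous_on (sphere 0 \<rho>) (\<lambda>\<xi>. integral (cbox 0 (1::real))
        (\<lambda>t. \<Phi> (linepath a b t) \<xi> * (b - a)))"
    proof (rule integral_continuous_on_param)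
      have "continuous_on (sphere 0 \<rho> \<times> cbox 0 1) (\<lambda>x. (\<lambda>(p, \<xi>). \<Phi> p \<xi>) (linepath a b (snd x), fst x))"
      proof (rule continuous_on_compose2[OF c])
        show "continuous_on (sphere 0 \<rho> \<times> cbox 0 1) (\<lambda>x. (linepath a b (snd x), fst x))"
          unfolding linepath_def by (intro continuous_intros)
        show "(\<lambda>x. (linepath a b (snd x), fst x)) ` (sphere 0 \<rho> \<times> cbox 0 1) \<subseteq> T \<times> sphere 0 \<rho>"
          using ab linepath_in_path by fastforce
      qed
      then show "continuous_on (sphere 0 \<rho> \<times> cbox 0 1) (\<lambda>(x, t). \<Phi> (linepath a b t) x * (b - a))"
        unfolding split_def by (intro continuous_intros) auto
    qed
    then have "continuous_on (sphere 0 \<rho>) (\<lambda>\<xi>. contour_integral (linepath a b) (\<lambda>t. \<Phi> t \<xi>))"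
      by (simp add: contour_integral_integral)
    then show ?thesis
      using \<open>0 \<le> \<rho>\<close> by (intro contour_integrable_continuous_circlepath) auto
  qed
  have "?I analytic_on T"
  proof (rule Morera_triangle[OF ci \<open>open T\<close>], intro impI)
    fix a b c assume abc: "convex hull {a, b, c} \<subseteq> T"
    have seg: "closed_segment a b \<subseteq> T" "closed_segment b c \<subseteq> T" "closed_segment c a \<subseteq> T"
      using abc by (meson convex_contains_segment convex_convex_hull hull_inc insertCI order_trans)+
    have "contour_integral (linepath a b) (\<lambda>t. \<Phi> t \<xi>) + contour_integral (linepath b c) (\<lambda>t. \<Phi> t \<xi>) 
        + contour_integral (linepath c a) (\<lambda>t. \<Phi> t \<xi>) = 0" if "\<xi> \<in> sphere 0 \<rho>" for \<xi>
    proof -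
      have hT: "(\<lambda>t. \<Phi> t \<xi>) holomorphic_on T" by (rule h[OF that])
      have "((\<lambda>t. \<Phi> t \<xi>) has_contour_integral 0) (linepath a b +++ linepath b c +++ linepath c a)"
        by (rule Cauchy_theorem_triangle) (use holomorphic_on_subset[OF hT abc] in auto)
      moreover have "(\<lambda>t. \<Phi> t \<xi>) contour_integrable_on linepath x y" if "closed_segment x y \<subseteq> T" for x y
        using that hT by (intro contour_integrable_continuous_linepath continuous_on_subset[OF holomorphic_on_imp_continuous_on])
      ultimately show ?thesis
        using seg by (metis (no_types, lifting) has_chain_integral_chain_integral3)
    qed
    then have "contour_integral ?g (\<lambda>\<xi>. contour_integral (linepath a b) (\<lambda>t. \<Phi> t \<xi>) 
        + contour_integral (linepath b c) (\<lambda>t. \<Phi> t \<xi>) + contour_integral (linepath c a) (\<lambda>t. \<Phi> t \<xi>))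
        = contour_integral ?g (\<lambda>_. 0)"
      using pg by (intro contour_integral_eq) auto
    then show "contour_integral (linepath a b) ?I + contour_integral (linepath b c) ?I 
        + contour_integral (linepath c a) ?I = 0"
      using seg by (simp add: sw contour_integral_add int contour_integrable_add)
  qed
  then show ?thesis
    by (rule analytic_imp_holomorphic)
qed

context complex_structure
begin

text \<open>Directional derivatives, quotients by a linear functional and power sums over the zeros
  in a fibre are all shown to be holomorphic through this lemma.\<close>

lemma hol_contour_integral:
  assumes W: "csubspace W" "openin (top_of_set W) D" and "0 \<le> \<rho>"
    and c: "continuous_on (D \<times> sphere 0 \<rho>) (\<lambda>(p, \<xi>). \<Phi> p \<xi>)"
    and h: "\<And>\<xi>. \<xi> \<in> sphere 0 \<rho> \<Longrightarrow> hol W D (\<lambda>p. \<Phi> p \<xi>)"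
  shows "hol W D (\<lambda>p. contour_integral (circlepath 0 \<rho>) (\<Phi> p))"
  unfolding hol_def
proof (intro conjI ballI)
  show "continuous_on D (\<lambda>p. contour_integral (circlepath 0 \<rho>) (\<Phi> p))"
    using assms by (intro continuous_on_contour_integral_param)
  fix p q assume p: "p \<in> D" and q: "q \<in> W"
  obtain T where T: "open T" "0 \<in> T" "\<And>t. t \<in> T \<Longrightarrow> p + t \<bullet>\<^sub>c q \<in> D"
    using eventually_line_in[OF W p q] by (auto simp: eventually_nhds)
  have "(\<lambda>t. contour_integral (circlepath 0 \<rho>) (\<Phi> (p + t \<bullet>\<^sub>c q))) holomorphic_on T"
  proof (rule holomorphic_contour_integral_param)
    have "continuous_on (T \<times> sphere 0 \<rho>) (\<lambda>x. (\<lambda>(p, \<xi>). \<Phi> p \<xi>) (p + fst x \<bullet>\<^sub>c q, snd x))"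
      by (rule continuous_on_compose2[OF c]) (use T in \<open>auto intro!: continuous_intros\<close>)
    then show "continuous_on (T \<times> sphere 0 \<rho>) (\<lambda>(t, \<xi>). \<Phi> (p + t \<bullet>\<^sub>c q) \<xi>)"
      by (simp add: split_def)
    show "(\<lambda>t. \<Phi> (p + t \<bullet>\<^sub>c q) \<xi>) holomorphic_on T" if "\<xi> \<in> sphere 0 \<rho>" for \<xi>
      by (rule hol_line[OF h[OF that] q, of T p, OF T(3)])
  qed (use assms T in auto)
  then show "(\<lambda>t. contour_integral (circlepath 0 \<rho>) (\<Phi> (p + t \<bullet>\<^sub>c q))) field_differentiable at 0"
    using T by (intro holomorphic_on_imp_differentiable_at) auto
qed

end

section \<open>Newton's identities and the argument principle\<close>

unbundle no vec_syntax

text \<open>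
  If \<open>s k\<close> is the \<open>k\<close>-th power sum of \<open>a\<^sub>1, a\<^sub>2, \<dots>\<close>, then \<open>newton s n\<close> is the coefficient of
  \<open>X^n\<close> in \<open>\<Prod>j. (1 - a\<^sub>j X)\<close>.  Every \<open>newton s n\<close> is a polynomial in the \<open>s k\<close>, so it is
  holomorphic in any parameter in which the power sums are.
\<close>

fun newton :: "(nat \<Rightarrow> complex) \<Rightarrow> nat \<Rightarrow> complex" where
  "newton s 0 = 1"
| "newton s (Suc n) = - (\<Sum>i\<le>n. newton s i * s (Suc n - i)) / of_nat (Suc n)"

text \<open>The recursion of \<open>newton\<close> is the comparison of coefficients in
  \<open>P' = - P * S\<close>, where \<open>S\<close> is the generating function of the power sums
  with exponent at least 1. These are Newton's identities.\<close>

lemma newton_eq_fps_nth: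
  fixes P :: "complex fps"
  assumes "fps_deriv P = - P * Abs_fps (\<lambda>k. s (Suc k))" "P $ 0 = 1"
  shows "newton s n = P $ n"
proof (induction n rule: less_induct)
  case (less n)
  show ?case
  proof (cases n)
    case 0
    then show ?thesis using assms by simp
  next
    case (Suc k)
    have "of_nat (Suc k) * P $ Suc k = fps_deriv P $ k"
      by simp
    also have "\<dots> = - (P * Abs_fps (\<lambda>k. s (Suc k))) $ k"
      by (simp add: assms(1))
    also have "\<dots> = - (\<Sum>i\<le>k. P $ i * s (Suc k - i))"
      by (simp add: fps_mult_nth atMost_atLeast0 Suc_diff_le)
    also have "\<dots> = - (\<Sum>i\<le>k. newton s i * s (Suc k - i))"
      using less Suc by simp
    finally have "P $ Suc k = - (\<Sum>i\<le>k. newton s i * s (Suc k - i)) / of_nat (Suc k)"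
      by (simp add: field_simps del: of_nat_Suc)
    then show ?thesis
      using Suc by simp
  qed
qed

lemma fps_deriv_power_linear_factor:
  fixes a :: complex
  shows "fps_deriv ((1 - fps_const a * fps_X) ^ m) =
    - ((1 - fps_const a * fps_X) ^ m) * Abs_fps (\<lambda>k. of_nat m * a ^ Suc k)"
proof -
  let ?q = "1 - fps_const a * fps_X" and ?S = "Abs_fps (\<lambda>k. a ^ Suc k)"
  \<comment> \<open>\<open>?S\<close> is the geometric series of \<open>a / (1 - a X)\<close>; it
    brings the derivative \<open>- a\<close> of \<open>?q\<close> into the form
    \<open>- ?q * ?S\<close>.\<close>
  have q: "?q * ?S = fps_const a"
  proof (rule fps_ext)
    show "(?q * ?S) $ n = fps_const a $ n" for n
      by (cases n) (simp_all add: left_diff_distrib mult.assoc)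
  qed
  have dq: "fps_deriv ?q = - (?q * ?S)"
    unfolding q by simp
  have S: "Abs_fps (\<lambda>k. of_nat m * a ^ Suc k) = of_nat m * ?S"
    by (rule fps_ext) (simp add: fps_of_nat[symmetric])
  show ?thesis
    unfolding S
  proof (induction m)
    case (Suc m)
    show ?case
      by (simp add: Suc dq del: fps_deriv_sub) (simp add: algebra_simps)
  qed simp
qed

lemma fps_logderiv_mult:
  fixes P Q :: "complex fps"
  assumes "fps_deriv P = - P * S" "fps_deriv Q = - Q * T"
  shows "fps_deriv (P * Q) = - (P * Q) * (S + T)"
  by (simp add: assms algebra_simps)

lemma fps_deriv_prod_linear_factors:
  fixes a :: "'i \<Rightarrow> complex"
  assumes "finite Z"
  shows "fps_deriv (\<Prod>\<xi>\<in>Z. (1 - fps_const (a \<xi>) * fps_X) ^ m \<xi>) =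
    - (\<Prod>\<xi>\<in>Z. (1 - fps_const (a \<xi>) * fps_X) ^ m \<xi>)
      * Abs_fps (\<lambda>k. \<Sum>\<xi>\<in>Z. of_nat (m \<xi>) * a \<xi> ^ Suc k)"
  using assms
proof (induction Z)
  case (insert \<xi> Z)
  have S: "Abs_fps (\<lambda>k. \<Sum>\<xi>\<in>insert \<xi> Z. of_nat (m \<xi>) * a \<xi> ^ Suc k) =
    Abs_fps (\<lambda>k. of_nat (m \<xi>) * a \<xi> ^ Suc k) + Abs_fps (\<lambda>k. \<Sum>\<xi>\<in>Z. of_nat (m \<xi>) * a \<xi> ^ Suc k)"
    using insert.hyps by (intro fps_ext) simp
  show ?case
    unfolding S prod.insert[OF insert.hyps]
    by (rule fps_logderiv_mult[OF fps_deriv_power_linear_factor insert.IH])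
qed (simp add: fps_eq_iff)

text \<open>Each factor \<open>1 - a X\<close> raises the degree bound by one and multiplies the
  coefficient at the bound by \<open>- a\<close>. The bound may exceed the degree: this coefficient
  vanishes when \<open>a = 0\<close>, and its vanishing is what is detected later.\<close>

lemma fps_nth_linear_factor_power_top:
  fixes a :: complex and Q :: "complex fps"
  assumes "\<And>i. i > d \<Longrightarrow> Q $ i = 0"
  shows "(\<forall>i>d + k. ((1 - fps_const a * fps_X) ^ k * Q) $ i = 0) \<and>
    ((1 - fps_const a * fps_X) ^ k * Q) $ (d + k) = (- a) ^ k * Q $ d"
proof (induction k)
  case (Suc k)
  let ?R = "(1 - fps_const a * fps_X) ^ k * Q"
  have "((1 - fps_const a * fps_X) ^ Suc k * Q) $ Suc i = ?R $ Suc i - a * ?R $ i" for i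
    by (simp add: mult.assoc left_diff_distrib)
  note R = this
  show ?case
  proof (intro conjI allI impI)
    fix i assume "i > d + Suc k"
    then obtain j where "i = Suc j" "j > d + k"
      by (metis Suc_lessE add_Suc_right)
    then show "((1 - fps_const a * fps_X) ^ Suc k * Q) $ i = 0"
      using Suc R by simp
  next
    show "((1 - fps_const a * fps_X) ^ Suc k * Q) $ (d + Suc k) = (- a) ^ Suc k * Q $ d"
      using Suc R[of "d + k"] by (simp del: power_Suc) simp
  qed
qed (use assms in simp)

lemma fps_nth_prod_linear_factors_top:
  fixes a :: "'i \<Rightarrow> complex"
  assumes "finite Z"
  shows "(\<forall>i>sum m Z. (\<Prod>\<xi>\<in>Z. (1 - fps_const (a \<xi>) * fps_X) ^ m \<xi>) $ i = 0) \<and>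
    (\<Prod>\<xi>\<in>Z. (1 - fps_const (a \<xi>) * fps_X) ^ m \<xi>) $ (sum m Z) = (\<Prod>\<xi>\<in>Z. (- a \<xi>) ^ m \<xi>)"
  using assms
proof (induction Z)
  case (insert \<xi> Z)
  then show ?case
    using fps_nth_linear_factor_power_top[of "sum m Z" "\<Prod>\<xi>\<in>Z. (1 - fps_const (a \<xi>) * fps_X) ^ m \<xi>" "m \<xi>" "a \<xi>"]
    by (simp add: add.commute)
qed simp

text \<open>With the factors written as \<open>1 - a X\<close>, the constant coefficient is 1, as
  the recursion demands, and the coefficient at the degree bound is the product of all
  \<open>- a \<xi>\<close>. The sum runs over indices, so equal values at different indices are
  counted separately.\<close>

lemma newton_power_sums_eq_0_iff:
  fixes a :: "'i \<Rightarrow> complex"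
  assumes "finite Z" "\<And>\<xi>. \<xi> \<in> Z \<Longrightarrow> m \<xi> > 0"
  shows "newton (\<lambda>k. \<Sum>\<xi>\<in>Z. of_nat (m \<xi>) * a \<xi> ^ k) (sum m Z) = 0 \<longleftrightarrow> (\<exists>\<xi>\<in>Z. a \<xi> = 0)"
proof -
  let ?P = "\<Prod>\<xi>\<in>Z. (1 - fps_const (a \<xi>) * fps_X) ^ m \<xi>"
  have "?P $ 0 = 1"
    using assms(1) by (induction Z) (simp_all add: fps_power_zeroth)
  then have "newton (\<lambda>k. \<Sum>\<xi>\<in>Z. of_nat (m \<xi>) * a \<xi> ^ k) (sum m Z) = ?P $ (sum m Z)"
    by (intro newton_eq_fps_nth fps_deriv_prod_linear_factors assms)
  also have "\<dots> = (\<Prod>\<xi>\<in>Z. (- a \<xi>) ^ m \<xi>)"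
    using fps_nth_prod_linear_factors_top[OF assms(1)] by blast
  finally show ?thesis
    using assms by auto
qed

text \<open>The multiplicities are chosen before the weight \<psi>, so the integrals for all powers
  of a function see the same weighted set of zeros.\<close>

lemma argument_principle_circle:
  fixes f :: "complex \<Rightarrow> complex"
  assumes f: "f holomorphic_on ball 0 R" and \<rho>: "0 < \<rho>" "\<rho> < R"
    and nz: "\<And>t. t \<in> sphere 0 \<rho> \<Longrightarrow> f t \<noteq> 0"
  obtains m where "finite {t \<in> ball 0 \<rho>. f t = 0}" 
    "\<And>\<xi>. \<xi> \<in> {t \<in> ball 0 \<rho>. f t = 0} \<Longrightarrow> m \<xi> > (0::nat)"
    "\<And>\<psi>. \<psi> holomorphic_on ball 0 R \<Longrightarrow> contour_integral (circlepath 0 \<rho>) (\<lambda>x. deriv f x * \<psi> x / f x) =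
       2 * of_real pi * \<i> * (\<Sum>\<xi>\<in>{t \<in> ball 0 \<rho>. f t = 0}. of_nat (m \<xi>) * \<psi> \<xi>)"
proof -
  \<comment> \<open>Zeros may accumulate at the boundary of \<open>ball 0 R\<close>. On the compact
    disc of an intermediate radius they are finite in number, as \<open>argument_principle\<close>
    requires of its domain.\<close>
  obtain R' where R': "\<rho> < R'" "R' < R"
    using dense \<rho> by blast
  let ?S = "ball 0 R' :: complex set"
  have nz0: "complex_of_real \<rho> \<in> ball 0 R" "f (of_real \<rho>) \<noteq> 0"
    using \<rho> nz by auto
  have fin: "finite {t \<in> cball 0 R'. f t = 0}"
  proof (rule ccontr)
    assume inf: "infinite {t \<in> cball 0 R'. f t = 0}"
    obtain x where x: "x \<in> cball 0 R'" "x islimpt {t \<in> cball 0 R'. f t = 0}"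
      using compact_cball[of 0 R', unfolded compact_eq_Bolzano_Weierstrass, rule_format,
          OF conjI, OF inf] by blast
    have "f (of_real \<rho>) = 0"
      by (rule analytic_continuation[OF f open_ball connected_ball _ _ x(2) _ nz0(1)])
        (use x R' in auto)
    then show False using nz0 by simp
  qed
  let ?pz = "{w \<in> ?S. f w = 0 \<or> w \<in> {}}" and ?Z = "{t \<in> ball 0 \<rho>. f t = 0}"
  define m where "m \<xi> = nat (zorder f \<xi>)" for \<xi>
  have fS: "f holomorphic_on ?S"
    using R' by (intro holomorphic_on_subset[OF f]) auto
  have nzex: "\<exists>w\<in>ball 0 R. f w \<noteq> 0"
    using nz0 by blast
  have zo: "zorder f \<xi> > 0" if "\<xi> \<in> ?Z" for \<xi>
    using zorder_exist_zero[OF f open_ball connected_ball  _ nzex, of \<xi>] that \<rho>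
    by (auto split: if_splits)
  have finp: "finite ?pz"
    by (rule finite_subset[OF _ fin]) auto
  show thesis
  proof
    show "finite ?Z"
      by (rule finite_subset[OF _ fin]) (use R' in auto)
    show "m \<xi> > 0" if "\<xi> \<in> ?Z" for \<xi>
      using zo[OF that] by (simp add: m_def)
    fix \<psi> assume \<psi>: "\<psi> holomorphic_on ball 0 R"
    have "contour_integral (circlepath 0 \<rho>) (\<lambda>x. deriv f x * \<psi> x / f x) =
      2 * pi * \<i> * (\<Sum>\<xi>\<in>?pz. winding_number (circlepath 0 \<rho>) \<xi> * \<psi> \<xi> * zorder f \<xi>)"
    proof (rule argument_principle)
      show "\<psi> holomorphic_on ?S"
        using R' by (intro holomorphic_on_subset[OF \<psi>]) auto
      show "path_image (circlepath 0 \<rho>) \<subseteq> ?S - ?pz"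
        using \<rho> R' nz by auto
      show "\<forall>z. z \<notin> ?S \<longrightarrow> winding_number (circlepath 0 \<rho>) z = 0"
        using \<rho> R' by (auto intro!: winding_number_zero_outside[of _ "cball 0 \<rho>"] simp: sphere_cball)
    qed (use fS finp in auto)
    also have "(\<Sum>\<xi>\<in>?pz. winding_number (circlepath 0 \<rho>) \<xi> * \<psi> \<xi> * of_int (zorder f \<xi>)) =
      (\<Sum>\<xi>\<in>?Z. of_nat (m \<xi>) * \<psi> \<xi>)"
    proof (rule sum.mono_neutral_cong_right)
      show "finite ?pz" by (rule finp)
      show "?Z \<subseteq> ?pz" using R' by auto
      show "\<forall>\<xi>\<in>?pz - ?Z. winding_number (circlepath 0 \<rho>) \<xi> * \<psi> \<xi> * of_int (zorder f \<xi>) = 0"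
      proof
        fix \<xi> assume "\<xi> \<in> ?pz - ?Z"
        then have "\<xi> \<notin> ball 0 \<rho>" "\<xi> \<notin> sphere 0 \<rho>"
          using nz by auto
        then have "winding_number (circlepath 0 \<rho>) \<xi> = 0"
          using \<rho> by (auto intro!: winding_number_zero_outside[of _ "cball 0 \<rho>"] simp: sphere_cball)
        then show "winding_number (circlepath 0 \<rho>) \<xi> * \<psi> \<xi> * of_int (zorder f \<xi>) = 0"
          by simp
      qed
      show "winding_number (circlepath 0 \<rho>) \<xi> * \<psi> \<xi> * of_int (zorder f \<xi>) = of_nat (m \<xi>) * \<psi> \<xi>" 
        if "\<xi> \<in> ?Z" for \<xi>
      proof -
        have "winding_number (circlepath 0 \<rho>) \<xi> = 1"
          using that by (intro winding_number_circlepath) auto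
        then show ?thesis
          using zo[OF that] by (simp add: m_def)
      qed
    qed
    finally show "contour_integral (circlepath 0 \<rho>) (\<lambda>x. deriv f x * \<psi> x / f x) =
       2 * of_real pi * \<i> * (\<Sum>\<xi>\<in>?Z. of_nat (m \<xi>) * \<psi> \<xi>)" by simp
  qed
qed

text \<open>A vector space over an infinite field is not a finite union of proper subspaces, here
  the subspaces of functions vanishing at a point of \<open>Z\<close>. At each new point a multiple
  of a function nonzero there is added, avoiding finitely many coefficients.\<close>

lemma nonvanishing_combination:
  fixes L :: "('b \<Rightarrow> complex) set"
  assumes "finite Z" "L \<noteq> {}"
    and closed: "\<And>g h c. g \<in> L \<Longrightarrow> h \<in> L \<Longrightarrow> (\<lambda>x. g x + c * h x) \<in> L"
    and "\<And>\<xi>. \<xi> \<in> Z \<Longrightarrow> \<exists>g\<in>L. g \<xi> \<noteq> 0"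
  shows "\<exists>h\<in>L. \<forall>\<xi>\<in>Z. h \<xi> \<noteq> 0"
  using assms(1,4)
proof (induction Z)
  case empty
  then show ?case using assms(2) by auto
next
  case (insert \<xi> Z)
  then obtain h g where h: "h \<in> L" "\<forall>\<xi>\<in>Z. h \<xi> \<noteq> 0" and g: "g \<in> L" "g \<xi> \<noteq> 0"
    by (metis insertCI)
  have "finite ((\<lambda>\<eta>. - h \<eta> / g \<eta>) ` insert \<xi> Z \<union> {0})"
    using insert.hyps by simp
  then obtain c where c: "c \<notin> (\<lambda>\<eta>. - h \<eta> / g \<eta>) ` insert \<xi> Z \<union> {0}"
    using ex_new_if_finite infinite_UNIV_char_0 by metis
  have "h \<eta> + c * g \<eta> \<noteq> 0" if \<eta>: "\<eta> \<in> insert \<xi> Z" for \<eta>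
  proof (cases "g \<eta> = 0")
    case True
    then show ?thesis using h g \<eta> by auto
  next
    case False
    moreover have "c \<noteq> - h \<eta> / g \<eta>"
      using c \<eta> by blast
    ultimately show ?thesis
      by (metis add_eq_0_iff nonzero_mult_div_cancel_right)
  qed
  then show ?case
    by (intro bexI[OF _ closed[OF h(1) g(1), of c]]) blast
qed

lemma common_zero_if_combinations_vanish:
  fixes L :: "('b \<Rightarrow> complex) set"
  assumes "finite Z" "L \<noteq> {}"
    and "\<And>g h c. g \<in> L \<Longrightarrow> h \<in> L \<Longrightarrow> (\<lambda>x. g x + c * h x) \<in> L"
    and "\<And>h. h \<in> L \<Longrightarrow> \<exists>\<xi>\<in>Z. h \<xi> = 0"
  shows "\<exists>\<xi>\<in>Z. \<forall>h\<in>L. h \<xi> = 0"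
  using nonvanishing_combination[of Z L] assms by blast

section \<open>Dividing by a linear coordinate\<close>

context complex_structure
begin

lemma uniform_line_in:
  assumes W: "csubspace W" "openin (top_of_set W) D" and "p \<in> D" "v \<in> W"
  obtains e \<rho> where "e > 0" "\<rho> > 0"
    "\<And>x t. x \<in> W \<Longrightarrow> x \<in> ball p e \<Longrightarrow> norm t \<le> \<rho> \<Longrightarrow> x + t \<bullet>\<^sub>c v \<in> D"
proof -
  obtain O' where O': "open O'" "D = W \<inter> O'"
    using assms(2) by (auto simp: openin_open)
  then obtain d where d: "d > 0" "ball p d \<subseteq> O'"
    using \<open>p \<in> D\<close> by (meson IntD2 open_contains_ball)
  obtain K where K: "K > 0" "\<And>c x. norm (c \<bullet>\<^sub>c x) \<le> norm c * norm x * K"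
    using bounded_bilinear.pos_bounded[OF bounded_bilinear_cscale] by blast
  \<comment> \<open>The summand 1 keeps \<open>c\<close> positive for \<open>v = 0\<close>. Half of
    \<open>d\<close> is left for the base point \<open>x\<close>, the other half for the
    displacement along \<open>v\<close>.\<close>
  define c where "c = norm v * K + 1"
  define \<rho> where "\<rho> = d / (2 * c)"
  have pos: "c > 0"
    using K by (simp add: c_def add_nonneg_pos)
  show thesis
  proof
    show "d / 2 > 0" "\<rho> > 0"
      using d pos by (auto simp: \<rho>_def)
    fix x t assume x: "x \<in> W" "x \<in> ball p (d / 2)" and t: "norm (t::complex) \<le> \<rho>"
    have "norm (t \<bullet>\<^sub>c v) \<le> norm t * (norm v * K)"
      using K(2)[of t v] by (simp add: mult.assoc)
    also have "\<dots> \<le> \<rho> * (norm v * K)"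
      using t K by (intro mult_right_mono) auto
    also have "\<dots> < \<rho> * c"
      using \<open>\<rho> > 0\<close> by (simp add: c_def)
    also have "\<dots> = d / 2"
      using pos by (simp add: \<rho>_def)
    finally have "dist p (x + t \<bullet>\<^sub>c v) < d"
      using x dist_triangle[of p "x + t \<bullet>\<^sub>c v" x] by (simp add: dist_norm)
    then show "x + t \<bullet>\<^sub>c v \<in> D"
      using d O' x W \<open>v \<in> W\<close> by (auto intro: csubspaceD)
  qed
qed

lemma continuous_on_line_param:
  assumes "continuous_on D f" "\<And>x t. x \<in> N \<Longrightarrow> t \<in> T \<Longrightarrow> x + t \<bullet>\<^sub>c v \<in> D"
  shows "continuous_on (N \<times> T) (\<lambda>z. f (fst z + snd z \<bullet>\<^sub>c v))"
  by (rule continuous_on_compose2[OF assms(1)])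
    (use assms(2) in \<open>auto intro!: continuous_intros\<close>)

text \<open>Cauchy's formula for the derivative, with one circle that serves all base points near
  \<open>p\<close>.\<close>

lemma hol_directional_deriv:
  assumes W: "csubspace W" "openin (top_of_set W) D" and f: "hol W D f" and v: "v \<in> W"
  shows "hol W D (\<lambda>p. deriv (\<lambda>t. f (p + t \<bullet>\<^sub>c v)) 0)"
proof (rule hol_local[OF W])
  fix p assume "p \<in> D"
  then obtain e \<rho> where e: "e > 0" "\<rho> > 0"
    and *: "\<And>x t. x \<in> W \<Longrightarrow> x \<in> ball p e \<Longrightarrow> norm t \<le> \<rho> \<Longrightarrow> x + t \<bullet>\<^sub>c v \<in> D"
    using uniform_line_in[OF W _ v] by blast
  let ?N = "D \<inter> ball p e"
  have "?N \<subseteq> W"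
    using openin_imp_subset[OF W(2)] by auto
  then have N: "x + t \<bullet>\<^sub>c v \<in> D" if "x \<in> ?N" "norm t \<le> \<rho>" for x t
    using * that by blast
  define g where "g x = 1 / (2 * of_real pi * \<i>) * contour_integral (circlepath 0 \<rho>)
      (\<lambda>\<tau>. f (x + \<tau> \<bullet>\<^sub>c v) / \<tau>\<^sup>2)" for x
  have "hol W ?N g"
    unfolding g_def
  proof (intro hol_mult hol_const hol_contour_integral)
    show "openin (top_of_set W) ?N"
      using W(2) by (simp add: openin_Int_open)
    have "continuous_on (?N \<times> sphere 0 \<rho>) (\<lambda>z. f (fst z + snd z \<bullet>\<^sub>c v))"
      using N by (intro continuous_on_line_param[OF holD(1)[OF f]]) auto
    then show "continuous_on (?N \<times> sphere 0 \<rho>) (\<lambda>(p, \<xi>). f (p + \<xi> \<bullet>\<^sub>c v) / \<xi>\<^sup>2)"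
      unfolding split_def using e by (intro continuous_intros) auto
    show "hol W ?N (\<lambda>p. f (p + \<xi> \<bullet>\<^sub>c v) / \<xi>\<^sup>2)" if "\<xi> \<in> sphere 0 \<rho>" for \<xi>
      using e that N by (intro hol_divide hol_shift[OF f] hol_const) auto
  qed (use W e in auto)
  moreover have "deriv (\<lambda>t. f (x + t \<bullet>\<^sub>c v)) 0 = g x" if "x \<in> ?N" for x
  proof -
    have h: "(\<lambda>t. f (x + t \<bullet>\<^sub>c v)) holomorphic_on cball 0 \<rho>"
      using N that by (intro hol_line[OF f v]) auto
    show ?thesis
      using Cauchy_derivative_integral_circlepath(2)[OF holomorphic_on_imp_continuous_on[OF h]
          holomorphic_on_subset[OF h ball_subset_cball], of 0] e
      by (auto simp: g_def dest: DERIV_imp_deriv)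
  qed
  ultimately show "\<exists>e>0. \<exists>g. hol W (D \<inter> ball p e) g \<and>
      (\<forall>x\<in>D \<inter> ball p e. deriv (\<lambda>t. f (x + t \<bullet>\<^sub>c v)) 0 = g x)"
    using e by blast
qed

text \<open>On the hyperplane \<open>z = 0\<close> the quotient is continued by its limit along
  \<open>e\<close>: there \<open>z (p + t \<bullet>\<^sub>c e) = t\<close>, so the limit is the
  derivative of \<open>g\<close> in this direction.\<close>

lemma hol_divide_functional:
  assumes W: "csubspace W" "openin (top_of_set W) D" and g: "hol W D g"
    and z: "clinear z" and e: "e \<in> W" "z e = 1" and g0: "\<And>p. p \<in> D \<Longrightarrow> z p = 0 \<Longrightarrow> g p = 0"
  shows "hol W D (\<lambda>p. if z p = 0 then deriv (\<lambda>t. g (p + t \<bullet>\<^sub>c e)) 0 else g p / z p)"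
    (is "hol W D ?h")
proof (rule hol_local[OF W])
  fix p assume p: "p \<in> D"
  note z_simps = clinearD(2-5)[OF z]
  have zcont: "\<forall>\<^sub>F x in nhds p. P (z x)" if "open {c. P c}" "P (z p)" for P
  proof -
    have "open (z -` {c. P c})"
      using clinearD(6)[OF z] that(1) by (intro open_vimage) auto
    then show ?thesis
      using that(2) by (auto simp: eventually_nhds intro!: exI[of _ "z -` {c. P c}"])
  qed
  show "\<exists>d>0. \<exists>h. hol W (D \<inter> ball p d) h \<and> (\<forall>x\<in>D \<inter> ball p d. ?h x = h x)"
  proof (cases "z p = 0")
    case False
    have "\<forall>\<^sub>F x in nhds p. z x \<noteq> 0"
      using False by (intro zcont) (auto intro!: open_Collect_neq continuous_intros)
    then obtain d where d: "d > 0" "\<forall>x. dist x p < d \<longrightarrow> z x \<noteq> 0"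
      by (auto simp: eventually_nhds_metric)
    have "hol W (D \<inter> ball p d) (\<lambda>p. g p / z p)"
      using d by (intro hol_divide hol_mono[OF g] hol_clinear z) (auto simp: dist_commute)
    moreover have "\<forall>x\<in>D \<inter> ball p d. ?h x = g x / z x"
      using d by (auto simp: dist_commute)
    ultimately show ?thesis
      using d(1) by blast
  next
    case True
    obtain d0 r where d0: "d0 > 0" "r > 0"
      and *: "\<And>x t. x \<in> W \<Longrightarrow> x \<in> ball p d0 \<Longrightarrow> norm t \<le> r \<Longrightarrow> x + t \<bullet>\<^sub>c e \<in> D"
      using uniform_line_in[OF W p e(1)] by blast
    \<comment> \<open>A circle strictly inside \<open>ball 0 r\<close>, where Cauchy's formula
      applies. Requiring \<open>norm (z x) < \<rho>\<close> below keeps \<open>- z x\<close> inside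
      the circle, so the denominator has no zero on it.\<close>
    define \<rho> where "\<rho> = r / 2"
    have \<rho>: "\<rho> > 0" "\<rho> < r" using d0 by (auto simp: \<rho>_def)
    have "\<forall>\<^sub>F x in nhds p. norm (z x) < \<rho>"
      using True \<rho> by (intro zcont) (auto intro!: open_Collect_less continuous_intros)
    then obtain d1 where d1: "d1 > 0" "\<forall>x. dist x p < d1 \<longrightarrow> norm (z x) < \<rho>"
      by (auto simp: eventually_nhds_metric)
    let ?d = "min d0 d1"
    let ?N = "D \<inter> ball p ?d"
    have "?N \<subseteq> W"
      using openin_imp_subset[OF W(2)] by auto
    then have N: "x + t \<bullet>\<^sub>c e \<in> D" if "x \<in> ?N" "norm t \<le> r" for x t
      using * that by auto
    have zN: "norm (z x) < \<rho>" if "x \<in> ?N" for x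
      using d1 that by (auto simp: dist_commute)
    have nz: "\<tau> + z x \<noteq> 0" "\<tau> \<noteq> 0" if "x \<in> ?N" "\<tau> \<in> sphere 0 \<rho>" for x \<tau>
    proof -
      show "\<tau> \<noteq> 0" using that \<rho> by auto
      show "\<tau> + z x \<noteq> 0"
        using zN[OF that(1)] that(2) by (metis add_eq_0_iff dist_0_norm less_irrefl mem_sphere norm_minus_cancel)
    qed
    \<comment> \<open>The quotient at \<open>x\<close> is the value at \<open>\<tau> = 0\<close> of \<open>\<tau> \<mapsto> g (x + \<tau> \<bullet>\<^sub>c e) / (\<tau> + z x)\<close>, whose
      singularity at \<open>\<tau> = - z x\<close> is removable, so it is given by Cauchy's formula.\<close>
    define h where "h x = 1 / (2 * of_real pi * \<i>) * contour_integral (circlepath 0 \<rho>)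
      (\<lambda>\<tau>. g (x + \<tau> \<bullet>\<^sub>c e) / (\<tau> + z x) / \<tau>)" for x
    have "hol W ?N h"
      unfolding h_def
    proof (intro hol_mult hol_const hol_contour_integral)
      show "openin (top_of_set W) ?N"
        using W(2) by (simp add: openin_Int_open)
      have "continuous_on (?N \<times> sphere 0 \<rho>) (\<lambda>y. g (fst y + snd y \<bullet>\<^sub>c e))"
        using N \<rho> by (intro continuous_on_line_param[OF holD(1)[OF g]]) auto
      then show "continuous_on (?N \<times> sphere 0 \<rho>) (\<lambda>(p, \<xi>). g (p + \<xi> \<bullet>\<^sub>c e) / (\<xi> + z p) / \<xi>)"
        unfolding split_def using nz
        by (intro continuous_intros continuous_on_compose2[OF clinearD(6)[OF z, of UNIV]]) auto
      show "hol W ?N (\<lambda>p. g (p + \<xi> \<bullet>\<^sub>c e) / (\<xi> + z p) / \<xi>)" if "\<xi> \<in> sphere 0 \<rho>" for \<xi>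
        using that nz \<rho> N by (intro hol_divide hol_shift[OF g] hol_add hol_clinear[OF z] hol_const) auto
    qed (use W \<rho> in auto)
    moreover have "?h x = h x" if x: "x \<in> ?N" for x
    proof -
      let ?T = "ball 0 r" and ?a = "- z x"
      define G where "G \<tau> = g (x + \<tau> \<bullet>\<^sub>c e)" for \<tau>
      have GT: "G holomorphic_on ?T"
        unfolding G_def using N x by (intro hol_line[OF g e(1)]) auto
      have aT: "?a \<in> ?T"
        using zN[OF x] \<rho> by auto
      \<comment> \<open>The line through \<open>x\<close> in direction \<open>e\<close> meets the
        hyperplane \<open>z = 0\<close> at parameter \<open>- z x\<close>.\<close>
      have Ga: "G ?a = 0"
        unfolding G_def using N[OF x, of ?a] aT by (intro g0) (auto simp: z_simps e)
      define w where "w \<tau> = (if \<tau> = ?a then deriv G ?a else (G \<tau> - G ?a) / (\<tau> - ?a))" for \<tau>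
      have wT: "w holomorphic_on ?T"
        using pole_lemma_open[OF GT open_ball, of ?a] by (simp add: w_def[abs_def])
      have w0: "w 0 = ?h x"
      proof (cases "z x = 0")
        case True
        then show ?thesis by (simp add: w_def G_def[abs_def])
      next
        case False
        then show ?thesis by (simp add: w_def Ga) (simp add: G_def)
      qed
      have "((\<lambda>u. w u / (u - 0)) has_contour_integral 2 * of_real pi * \<i> * w 0) (circlepath 0 \<rho>)"
        using \<rho> by (intro Cauchy_integral_circlepath_simple holomorphic_on_subset[OF wT]) auto
      then have "contour_integral (circlepath 0 \<rho>) (\<lambda>u. w u / u) = 2 * of_real pi * \<i> * w 0"
        by (simp add: contour_integral_unique)
      moreover have "w \<tau> = G \<tau> / (\<tau> + z x)" if "\<tau> \<in> sphere 0 \<rho>" for \<tau>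
        using nz(1)[OF x that] by (auto simp: w_def Ga eq_neg_iff_add_eq_0)
      then have "contour_integral (circlepath 0 \<rho>) (\<lambda>u. w u / u) =
          contour_integral (circlepath 0 \<rho>) (\<lambda>\<tau>. g (x + \<tau> \<bullet>\<^sub>c e) / (\<tau> + z x) / \<tau>)"
        using \<rho> by (intro contour_integral_eq) (auto simp: G_def)
      ultimately show ?thesis
        by (simp add: h_def w0)
    qed
    ultimately show ?thesis
      using d0 d1 by (intro exI[of _ ?d]) auto
  qed
qed

text \<open>
  The hypothesis on the limit bounds by \<open>n\<close> the number of times that \<open>z\<close> can be divided out
  of \<open>g\<close>.
\<close>

lemma hol_factor_functional:
  assumes W: "csubspace W" "openin (top_of_set W) D" and z: "clinear z" and e: "e \<in> W" "z e = 1"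
    and g: "hol W D g" and b: "b \<in> D" "z b = 0"
    and lim: "((\<lambda>t. g (b + t \<bullet>\<^sub>c e) / t ^ n) \<longlongrightarrow> l) (at 0)" "l \<noteq> 0"
  shows "\<exists>k f. hol W D f \<and> (\<forall>p\<in>D. g p = z p ^ k * f p) \<and> (\<exists>p\<in>D. z p = 0 \<and> f p \<noteq> 0)"
  using g lim(1)
proof (induction n arbitrary: g)
  note z_simps = clinearD(2-5)[OF z] e(2)
  note line = eventually_line_in[OF W b(1) e(1)]
  {
    case 0
    have "(\<lambda>t. g (b + t \<bullet>\<^sub>c e)) field_differentiable at 0"
      by (rule holD(2)[OF 0(1) b(1) e(1)])
    then have "isCont (\<lambda>t. g (b + t \<bullet>\<^sub>c e)) 0"
      by (rule field_differentiable_imp_continuous_at)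
    then have "((\<lambda>t. g (b + t \<bullet>\<^sub>c e)) \<longlongrightarrow> g b) (at 0)"
      by (simp add: isCont_def)
    moreover have "((\<lambda>t. g (b + t \<bullet>\<^sub>c e)) \<longlongrightarrow> l) (at 0)"
      using 0(2) by simp
    ultimately have "g b = l"
      using tendsto_unique trivial_limit_at by blast
    then show ?case
      using 0(1) b lim(2) by (intro exI[of _ 0] exI[of _ g]) auto
  next
    case (Suc n)
    show ?case
    proof (cases "\<exists>p\<in>D. z p = 0 \<and> g p \<noteq> 0")
      case True
      then show ?thesis
        using Suc.prems(1) by (intro exI[of _ 0] exI[of _ g]) auto
    next
      case False
      define h where "h p = (if z p = 0 then deriv (\<lambda>t. g (p + t \<bullet>\<^sub>c e)) 0 else g p / z p)" for p
      have h: "hol W D h"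
        unfolding h_def by (rule hol_divide_functional[OF W Suc.prems(1) z e]) (use False in blast)
      have "\<forall>\<^sub>F t in at 0. g (b + t \<bullet>\<^sub>c e) / t ^ Suc n = h (b + t \<bullet>\<^sub>c e) / t ^ n"
        by (auto simp: eventually_at_filter h_def z_simps b)
      then have "((\<lambda>t. h (b + t \<bullet>\<^sub>c e) / t ^ n) \<longlongrightarrow> l) (at 0)"
        by (rule Lim_transform_eventually[OF Suc.prems(2)])
      from Suc.IH[OF h this] obtain k f where f: "hol W D f" "\<forall>p\<in>D. h p = z p ^ k * f p"
        "\<exists>p\<in>D. z p = 0 \<and> f p \<noteq> 0"
        by blast
      have "g p = z p ^ Suc k * f p" if "p \<in> D" for p
      proof (cases "z p = 0")
        case True
        then show ?thesis using False that by auto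
      next
        case nz: False
        then have "g p = z p * h p"
          by (simp add: h_def)
        then show ?thesis
          using f(2) that by simp
      qed
      then show ?thesis
        using f by blast
    qed
  }
qed

text \<open>By the identity theorem on the complex line through 0 and \<open>p\<close>, there are
  points \<open>q\<close> arbitrarily near 0 with \<open>g q \<noteq> 0\<close>. Let
  \<open>b\<close> be the projection of such a \<open>q\<close> along \<open>e\<close> to
  \<open>z = 0\<close>. The line from \<open>b\<close> in direction \<open>e\<close> passes through
  \<open>q\<close>, so \<open>g\<close> is not identically zero on it and has a finite order
  \<open>n\<close> at \<open>b\<close>. Taking \<open>q\<close> near 0 keeps the segment used inside
  the ball.\<close>

lemma hol_order_exists:
  assumes W: "csubspace W" "r > 0" and z: "clinear z" and e: "e \<in> W" "z e = 1"
    and g: "hol W (W \<inter> ball 0 r) g" and p: "p \<in> W \<inter> ball 0 r" "g p \<noteq> 0"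
  obtains b n l where "b \<in> W \<inter> ball 0 r" "z b = 0" "l \<noteq> 0"
    "((\<lambda>t. g (b + t \<bullet>\<^sub>c e) / t ^ n) \<longlongrightarrow> l) (at 0)"
proof -
  let ?D = "W \<inter> ball 0 r"
  note z_simps = clinearD(2-5)[OF z] e(2)
  have Wo: "openin (top_of_set W) ?D"
    by (simp add: openin_open_Int)
  have D0: "0 \<in> ?D"
    using W by (simp add: csubspaceD)
  obtain d \<rho> where d: "d > 0" "\<rho> > 0"
    and line: "\<And>x t. x \<in> W \<Longrightarrow> x \<in> ball 0 d \<Longrightarrow> norm t \<le> \<rho> \<Longrightarrow> x + t \<bullet>\<^sub>c e \<in> ?D"
    using uniform_line_in[OF W(1) Wo D0 e(1)] by blast
  have "\<forall>\<^sub>F t in nhds 0. t \<bullet>\<^sub>c p \<in> ball 0 d"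
    using topological_tendstoD[OF tendsto_cscale[OF filterlim_ident tendsto_const], of "ball 0 d" 0 p] d
    by simp
  moreover have "((\<lambda>t. t * z p) \<longlongrightarrow> 0 * z p) (nhds 0)"
    by (intro tendsto_intros filterlim_ident)
  then have "\<forall>\<^sub>F t in nhds 0. t * z p \<in> ball 0 (\<rho> / 2)"
    using d by (intro topological_tendstoD) auto
  ultimately have "\<forall>\<^sub>F t in nhds 0. t \<bullet>\<^sub>c p \<in> ball 0 d \<and> t * z p \<in> ball 0 (\<rho> / 2)"
    by (rule eventually_conj)
  then obtain \<eta> where \<eta>: "\<eta> > 0"
    "\<And>t. norm t < \<eta> \<Longrightarrow> t \<bullet>\<^sub>c p \<in> ball 0 d \<and> t * z p \<in> ball 0 (\<rho> / 2)"
    by (auto simp: eventually_nhds_metric)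
  obtain t where t: "norm t < \<eta>" "g (t \<bullet>\<^sub>c p) \<noteq> 0"
  proof (rule ccontr)
    assume "\<not> thesis"
    then have 0: "g (t \<bullet>\<^sub>c p) = 0" if "norm t < \<eta>" for t
      using that \<open>\<And>t. cmod t < \<eta> \<Longrightarrow> g (t \<bullet>\<^sub>c p) \<noteq> 0 \<Longrightarrow> thesis\<close> by blast
    let ?T = "(\<lambda>t. t \<bullet>\<^sub>c p) -` ball 0 r"
    have lin: "linear (\<lambda>t. t \<bullet>\<^sub>c p)"
      using bounded_bilinear.bounded_linear_left[OF bounded_bilinear_cscale]
      by (rule bounded_linear.linear)
    have T: "open ?T" "connected ?T"
      by (auto intro!: open_vimage continuous_intros convex_connected convex_linear_vimage lin)
    have hT: "(\<lambda>t. g (0 + t \<bullet>\<^sub>c p)) holomorphic_on ?T"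
      using p W by (intro hol_line[OF g]) (auto intro: csubspaceD)
    have T0: "0 \<in> ?T"
      using W by simp
    have "g (0 + 1 \<bullet>\<^sub>c p) = 0"
    proof (rule analytic_continuation[OF hT T _ T0])
      show "?T \<inter> ball 0 \<eta> \<subseteq> ?T" by blast
      show "0 islimpt ?T \<inter> ball 0 \<eta>"
        using T T0 \<eta> by (intro open_imp_islimpt) auto
      show "1 \<in> ?T" using p by simp
    qed (use 0 in auto)
    then show False
      using p by simp
  qed
  define q where "q = t \<bullet>\<^sub>c p"
  define b where "b = q - z q \<bullet>\<^sub>c e"
  have q: "q \<in> W" "q \<in> ball 0 d" "norm (z q) < \<rho> / 2" "g q \<noteq> 0"
    using \<eta>(2)[OF t(1)] t(2) p W by (auto simp: q_def z_simps intro: csubspaceD)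
  have bt: "b + t \<bullet>\<^sub>c e = q + (t - z q) \<bullet>\<^sub>c e" for t
    by (simp add: b_def cscale_diff_left)
  have bD: "b + t \<bullet>\<^sub>c e \<in> ?D" if "t \<in> ball 0 (\<rho> / 2)" for t
    unfolding bt using q that norm_triangle_ineq4[of t "z q"] by (intro line) auto
  have \<Gamma>: "(\<lambda>t. g (b + t \<bullet>\<^sub>c e)) holomorphic_on ball 0 (\<rho> / 2)"
    using bD by (intro hol_line[OF g e(1)])
  have "\<exists>w\<in>ball 0 (\<rho> / 2). g (b + w \<bullet>\<^sub>c e) \<noteq> 0"
    using q by (intro bexI[of _ "z q"]) (auto simp: b_def)
  from zorder_exist_zero[OF \<Gamma> open_ball connected_ball _ this, of 0] d
  obtain n u s where u: "s > 0" "u holomorphic_on cball 0 s" 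
    "\<forall>w\<in>cball 0 s. g (b + w \<bullet>\<^sub>c e) = u w * w ^ n \<and> u w \<noteq> (0::complex)"
    by auto
  have "continuous_on (ball 0 s) u"
    by (rule continuous_on_subset[OF holomorphic_on_imp_continuous_on[OF u(2)]]) auto
  then have "(u \<longlongrightarrow> u 0) (at 0)"
    using u(1) by (simp add: continuous_on_eq_continuous_at isCont_def)
  moreover have "\<forall>\<^sub>F w in at 0. u w = g (b + w \<bullet>\<^sub>c e) / w ^ n"
    using u by (auto simp: eventually_at intro!: exI[of _ s])
  ultimately have "((\<lambda>w. g (b + w \<bullet>\<^sub>c e) / w ^ n) \<longlongrightarrow> u 0) (at 0)"
    by (rule Lim_transform_eventually)
  moreover have "b \<in> ?D"
    using bD[of 0] d by simp
  moreover have "z b = 0"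
    by (simp add: b_def z_simps)
  moreover have "u 0 \<noteq> 0"
    using u by simp
  ultimately show thesis
    using that by blast
qed

end

section \<open>Projecting zero sets to a linear coordinate\<close>

context complex_structure
begin

lemma hol_newton:
  assumes "\<And>k. hol W D (s k)"
  shows "hol W D (\<lambda>p. newton (\<lambda>k. s k p) n)"
proof (induction n rule: less_induct)
  case (less n)
  show ?case
  proof (cases n)
    case (Suc k)
    have "hol W D (\<lambda>p. (- 1 / of_nat (Suc k)) * (\<Sum>i\<le>k. newton (\<lambda>j. s j p) i * s (Suc k - i) p))"
      by (intro hol_mult hol_const hol_sum less assms) (simp add: Suc)
    then show ?thesis
      by (simp add: Suc)
  qed simp
qed

text \<open>
  Up to sign, \<open>N h p\<close> is the product of the values of \<open>h\<close> at the zeros of \<open>f\<close> on the disc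
  \<open>p + t \<bullet>\<^sub>c v\<close>, \<open>norm t < \<rho>\<close>.  The power sums of these values are contour integrals by the
  argument principle, and the number of zeros is a continuous integer, hence constant.
\<close>

lemma hol_fibre_norm:
  assumes W: "csubspace W" and v: "v \<in> W" and f: "hol W D f" and D: "openin (top_of_set W) D"
    and W': "csubspace W'" "W' \<subseteq> W" and D': "openin (top_of_set W') D'" "connected D'" "D' \<noteq> {}"
    and \<rho>: "0 < \<rho>" "\<rho> < R"
    and line: "\<And>p t. p \<in> D' \<Longrightarrow> norm t < R \<Longrightarrow> p + t \<bullet>\<^sub>c v \<in> D"
    and nz: "\<And>p t. p \<in> D' \<Longrightarrow> norm t = \<rho> \<Longrightarrow> f (p + t \<bullet>\<^sub>c v) \<noteq> 0"
  obtains N where "\<And>h. hol W D h \<Longrightarrow> hol W' D' (N h)"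
    "\<And>h p. hol W D h \<Longrightarrow> p \<in> D' \<Longrightarrow>
       N h p = 0 \<longleftrightarrow> (\<exists>t\<in>ball 0 \<rho>. f (p + t \<bullet>\<^sub>c v) = 0 \<and> h (p + t \<bullet>\<^sub>c v) = 0)"
    "\<And>p. p \<in> D' \<Longrightarrow> finite {t \<in> ball 0 \<rho>. f (p + t \<bullet>\<^sub>c v) = 0}"
proof -
  define Df where "Df q = deriv (\<lambda>t. f (q + t \<bullet>\<^sub>c v)) 0" for q
  have Df: "hol W D Df"
    unfolding Df_def by (rule hol_directional_deriv[OF W D f v])
  define S where "S h k p = 1 / (2 * of_real pi * \<i>) * contour_integral (circlepath 0 \<rho>)
    (\<lambda>\<xi>. Df (p + \<xi> \<bullet>\<^sub>c v) * h (p + \<xi> \<bullet>\<^sub>c v) ^ k / f (p + \<xi> \<bullet>\<^sub>c v))" for h :: "'v \<Rightarrow> complex" and k p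
  define Z where "Z p = {t \<in> ball 0 \<rho>. f (p + t \<bullet>\<^sub>c v) = 0}" for p
  have S: "hol W' D' (S h k)" if h: "hol W D h" for h k
    unfolding S_def
  proof (intro hol_mult hol_const hol_contour_integral W' D')
    have c: "continuous_on (D' \<times> sphere 0 \<rho>) (\<lambda>z. g (fst z + snd z \<bullet>\<^sub>c v))" if "hol W D g" for g
      using line \<rho> by (intro continuous_on_line_param[OF holD(1)[OF that]]) auto
    show "continuous_on (D' \<times> sphere 0 \<rho>)
       (\<lambda>(p, \<xi>). Df (p + \<xi> \<bullet>\<^sub>c v) * h (p + \<xi> \<bullet>\<^sub>c v) ^ k / f (p + \<xi> \<bullet>\<^sub>c v))"
      unfolding split_def using nz by (intro continuous_intros c h Df f) auto
    have sh: "hol W' D' (\<lambda>p. g (p + \<xi> \<bullet>\<^sub>c v))" if "hol W D g" "\<xi> \<in> sphere 0 \<rho>" for g \<xi>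
      using line \<rho> that(2) by (intro hol_shift[OF hol_mono[OF that(1) W'(2) order_refl]]) auto
    show "hol W' D' (\<lambda>p. Df (p + \<xi> \<bullet>\<^sub>c v) * h (p + \<xi> \<bullet>\<^sub>c v) ^ k / f (p + \<xi> \<bullet>\<^sub>c v))"
      if "\<xi> \<in> sphere 0 \<rho>" for \<xi>
      using nz that by (intro hol_divide hol_mult hol_power sh Df h f) auto
  qed (use \<rho> in auto)
  \<comment> \<open>One multiplicity function for all \<open>h\<close> and \<open>k\<close>:
    Newton's identities combine power sums of different exponents, which must carry the same
    weights.\<close>
  define is_mult where "is_mult p m \<longleftrightarrow> finite (Z p) \<and> (\<forall>\<xi>\<in>Z p. m \<xi> > (0::nat)) \<and>
    (\<forall>h k. hol W D h \<longrightarrow> S h k p = (\<Sum>\<xi>\<in>Z p. of_nat (m \<xi>) * h (p + \<xi> \<bullet>\<^sub>c v) ^ k))" for p m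
  have m_ex: "\<exists>m. is_mult p m" if p: "p \<in> D'" for p
  proof -
    have fl: "(\<lambda>t. f (p + t \<bullet>\<^sub>c v)) holomorphic_on ball 0 R"
      using line p by (intro hol_line[OF f v]) auto
    obtain m where m: "finite (Z p)" "\<And>\<xi>. \<xi> \<in> Z p \<Longrightarrow> m \<xi> > (0::nat)"
      and ap: "\<And>\<psi>. \<psi> holomorphic_on ball 0 R \<Longrightarrow> contour_integral (circlepath 0 \<rho>)
        (\<lambda>\<xi>. deriv (\<lambda>t. f (p + t \<bullet>\<^sub>c v)) \<xi> * \<psi> \<xi> / f (p + \<xi> \<bullet>\<^sub>c v)) =
        2 * of_real pi * \<i> * (\<Sum>\<xi>\<in>Z p. of_nat (m \<xi>) * \<psi> \<xi>)"
    proof (rule argument_principle_circle[OF fl \<rho>])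
      show "f (p + t \<bullet>\<^sub>c v) \<noteq> 0" if "t \<in> sphere 0 \<rho>" for t
        using nz[OF p] that by simp
    qed (rule that; simp add: Z_def)
    have Dfd: "deriv (\<lambda>t. f (p + t \<bullet>\<^sub>c v)) \<xi> = Df (p + \<xi> \<bullet>\<^sub>c v)" for \<xi>
      unfolding Df_def deriv_shift_0[of _ \<xi>] by (simp add: cscale_add_left add.assoc o_def)
    have "S h k p = (\<Sum>\<xi>\<in>Z p. of_nat (m \<xi>) * h (p + \<xi> \<bullet>\<^sub>c v) ^ k)" if h: "hol W D h" for h k
    proof -
      have "(\<lambda>t. h (p + t \<bullet>\<^sub>c v)) holomorphic_on ball 0 R"
        using line p by (intro hol_line[OF h v]) auto
      then have "(\<lambda>t. h (p + t \<bullet>\<^sub>c v) ^ k) holomorphic_on ball 0 R"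
        by (intro holomorphic_intros)
      from ap[OF this] show ?thesis
        by (simp add: S_def Dfd)
    qed
    then show ?thesis
      using m unfolding is_mult_def by blast
  qed
  then have "\<forall>p\<in>D'. \<exists>m. is_mult p m"
    by blast
  from bchoice[OF this] obtain m where "\<forall>p\<in>D'. is_mult p (m p)" ..
  then have fin: "\<And>p. p \<in> D' \<Longrightarrow> finite (Z p)"
    and mpos: "\<And>p \<xi>. p \<in> D' \<Longrightarrow> \<xi> \<in> Z p \<Longrightarrow> m p \<xi> > (0::nat)"
    and Ssum: "\<And>p h k. p \<in> D' \<Longrightarrow> hol W D h \<Longrightarrow>
      S h k p = (\<Sum>\<xi>\<in>Z p. of_nat (m p \<xi>) * h (p + \<xi> \<bullet>\<^sub>c v) ^ k)"
    unfolding is_mult_def by blast+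
  define d where "d p = sum (m p) (Z p)" for p
  \<comment> \<open>Since \<open>0 ^ 0 = 1\<close>, exponent 0 gives the integral of
    \<open>f' / f\<close>, which counts the zeros with multiplicity. It must not depend on
    \<open>p\<close>, because it is the index at which \<open>newton\<close> is evaluated.\<close>
  have d: "S (\<lambda>_. 0) 0 p = of_nat (d p)" if "p \<in> D'" for p
    using Ssum[OF that hol_const, of 0 0] by (simp add: d_def)
  have "S (\<lambda>_. 0) 0 constant_on D'"
  proof (rule continuous_discrete_range_constant[OF D'(2)])
    show "continuous_on D' (S (\<lambda>_. 0) 0)"
      by (rule holD(1)[OF S[OF hol_const]])
    have "1 \<le> norm (S (\<lambda>_. 0) 0 y - S (\<lambda>_. 0) 0 x)"
      if "x \<in> D'" "y \<in> D'" "S (\<lambda>_. 0) 0 y \<noteq> S (\<lambda>_. 0) 0 x" for x y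
    proof -
      have "S (\<lambda>_. 0) 0 y - S (\<lambda>_. 0) 0 x = of_int (int (d y) - int (d x))"
        by (simp add: d that)
      moreover have "int (d y) - int (d x) \<noteq> 0"
        using that d by auto
      ultimately show ?thesis
        by (simp only: norm_of_int)
    qed
    then show "\<exists>e>0. \<forall>y. y \<in> D' \<and> S (\<lambda>_. 0) 0 y \<noteq> S (\<lambda>_. 0) 0 x \<longrightarrow>
        e \<le> norm (S (\<lambda>_. 0) 0 y - S (\<lambda>_. 0) 0 x)" if "x \<in> D'" for x
      using that by (intro exI[of _ 1]) auto
  qed
  then obtain n where n: "\<And>p. p \<in> D' \<Longrightarrow> d p = n"
    using d D'(3) unfolding constant_on_def by (metis of_nat_eq_iff)
  show thesis
  proof
    show "hol W' D' (\<lambda>p. newton (\<lambda>k. S h k p) n)" if "hol W D h" for h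
      by (intro hol_newton S that)
    show "newton (\<lambda>k. S h k p) n = 0 \<longleftrightarrow>
      (\<exists>t\<in>ball 0 \<rho>. f (p + t \<bullet>\<^sub>c v) = 0 \<and> h (p + t \<bullet>\<^sub>c v) = 0)" if "hol W D h" "p \<in> D'" for h p
    proof -
      have "newton (\<lambda>k. S h k p) n = 0 \<longleftrightarrow> (\<exists>t\<in>Z p. h (p + t \<bullet>\<^sub>c v) = 0)"
        using newton_power_sums_eq_0_iff[of "Z p" "m p" "\<lambda>\<xi>. h (p + \<xi> \<bullet>\<^sub>c v)"] fin mpos that
          n[OF that(2)] by (simp add: Ssum d_def)
      then show ?thesis
        by (auto simp: Z_def)
    qed
    show "finite {t \<in> ball 0 \<rho>. f (p + t \<bullet>\<^sub>c v) = 0}" if "p \<in> D'" for p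
      using fin[OF that] by (simp add: Z_def)
  qed
qed

lemma continuous_on_nz_ball:
  fixes f :: "'v \<Rightarrow> complex"
  assumes "continuous_on D f" "p \<in> D" "f p \<noteq> 0"
  obtains \<epsilon> where "\<epsilon> > 0" "\<And>q. q \<in> D \<Longrightarrow> q \<in> ball p \<epsilon> \<Longrightarrow> f q \<noteq> 0"
  using continuous_within_avoid[of p D f 0] assms
  by (metis continuous_on_eq_continuous_within mem_ball)

text \<open>
  A local, one-parameter form of the proper mapping theorem.  A member of \<open>G\<close> that is not
  identically zero is \<open>z ^ k * f\<close> with \<open>f\<close> not identically zero on \<open>z = 0\<close>; away from \<open>z = 0\<close> the
  common zeros lie on \<open>f = 0\<close>, which is finite over a hyperplane transversal to a suitable
  direction \<open>v\<close> with \<open>z v = 0\<close>.  The norms along \<open>v\<close> cut out the image of the zero set in this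
  hyperplane, and induction on the dimension applies to them.
\<close>

lemma hol_zeros_project:
  assumes "csubspace W" and z: "clinear z" and "e \<in> W" "z e = 1" "r > 0"
    and "\<And>g. g \<in> G \<Longrightarrow> hol W (W \<inter> ball 0 r) g"
    and "\<And>\<epsilon>. \<epsilon> > 0 \<Longrightarrow> \<exists>p\<in>W \<inter> ball 0 \<epsilon>. z p \<noteq> 0 \<and> (\<forall>g\<in>G. g p = 0)"
  shows "\<exists>\<delta>>0. \<forall>c. norm c < \<delta> \<longrightarrow> (\<exists>p\<in>W \<inter> ball 0 r. z p = c \<and> (\<forall>g\<in>G. g p = 0))"
  using assms(1,3-)
proof (induction "dim W" arbitrary: W e r G rule: less_induct)
  case less
  note W = \<open>csubspace W\<close> and e = \<open>e \<in> W\<close> \<open>z e = 1\<close> and r = \<open>r > 0\<close> and G = less.prems(5) 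
    and acc = less.prems(6)
  note z_simps = clinearD(2-5)[OF z] e(2)
  let ?D = "W \<inter> ball 0 r"
  have Do: "openin (top_of_set W) ?D"
    by (simp add: openin_open_Int)
  have D0: "0 \<in> ?D"
    using W r by (simp add: csubspaceD)
  show ?case
  proof (cases "\<forall>g\<in>G. \<forall>p\<in>?D. g p = 0")
    case True
    have "\<forall>\<^sub>F c in nhds 0. 0 + c \<bullet>\<^sub>c e \<in> ?D"
      by (rule eventually_line_in[OF W Do D0 e(1)])
    then obtain \<delta> where "\<delta> > 0" "\<forall>c. norm c < \<delta> \<longrightarrow> c \<bullet>\<^sub>c e \<in> ?D"
      by (auto simp: eventually_nhds_metric)
    moreover have "\<exists>p\<in>?D. z p = c \<and> (\<forall>g\<in>G. g p = 0)" if "c \<bullet>\<^sub>c e \<in> ?D" for c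
    proof (intro bexI[OF _ that] conjI ballI)
      show "z (c \<bullet>\<^sub>c e) = c" by (simp add: z_simps)
      show "g (c \<bullet>\<^sub>c e) = 0" if "g \<in> G" for g
        using True that \<open>c \<bullet>\<^sub>c e \<in> ?D\<close> by blast
    qed
    ultimately show ?thesis
      by blast
  next
    case False
    then obtain g0 p0 where g0: "g0 \<in> G" and p0: "p0 \<in> ?D" "g0 p0 \<noteq> 0"
      by blast
    obtain b n l where "b \<in> ?D" "z b = 0" "((\<lambda>t. g0 (b + t \<bullet>\<^sub>c e) / t ^ n) \<longlongrightarrow> l) (at 0)" "l \<noteq> 0"
      using hol_order_exists[OF W r z e G[OF g0] p0] by blast
    from hol_factor_functional[OF W Do z e G[OF g0] this]
    obtain k f v where f: "hol W ?D f" "\<And>p. p \<in> ?D \<Longrightarrow> g0 p = z p ^ k * f p"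
      and v: "v \<in> ?D" "z v = 0" "f v \<noteq> 0"
      by blast
    have f_zero: "f p = 0" if "p \<in> ?D" "z p \<noteq> 0" "\<forall>g\<in>G. g p = 0" for p
      using f(2)[OF that(1)] that g0 by auto
    \<comment> \<open>Common zeros off \<open>z = 0\<close> lie on \<open>f = 0\<close> and
      accumulate at 0. As \<open>f v \<noteq> 0\<close>, it follows that
      \<open>v \<noteq> 0\<close>, so \<open>v\<close> can serve as the direction of
      projection.\<close>
    have f0: "f 0 = 0"
    proof (rule ccontr)
      assume "f 0 \<noteq> 0"
      then obtain \<epsilon> where \<epsilon>: "\<epsilon> > 0" "\<And>q. q \<in> ?D \<Longrightarrow> q \<in> ball 0 \<epsilon> \<Longrightarrow> f q \<noteq> 0"
        using continuous_on_nz_ball[OF holD(1)[OF f(1)] D0] by blast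
      obtain p where "p \<in> W \<inter> ball 0 (min \<epsilon> r)" "z p \<noteq> 0" "\<forall>g\<in>G. g p = 0"
        using acc[of "min \<epsilon> r"] \<epsilon>(1) r by auto
      then show False
        using f_zero[of p] \<epsilon>(2)[of p] by auto
    qed
    have vW: "v \<in> W" and v0: "v \<noteq> 0"
      using v f0 by auto
    \<comment> \<open>\<open>f\<close> is not identically zero on the line through 0 and
      \<open>v\<close>, so its zero at 0 is isolated on this line.\<close>
    obtain s where s: "s > 0" "\<And>t. t \<noteq> 0 \<Longrightarrow> norm t < s \<Longrightarrow> f (t \<bullet>\<^sub>c v) \<noteq> 0"
    proof -
      let ?T = "(\<lambda>t. t \<bullet>\<^sub>c v) -` ball 0 r"
      have lin: "linear (\<lambda>t. t \<bullet>\<^sub>c v)"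
        using bounded_bilinear.bounded_linear_left[OF bounded_bilinear_cscale]
        by (rule bounded_linear.linear)
      have T: "open ?T" "connected ?T" "0 \<in> ?T" "1 \<in> ?T"
        using v r by (auto intro!: open_vimage continuous_intros convex_connected convex_linear_vimage lin)
      have "(\<lambda>t. f (0 + t \<bullet>\<^sub>c v)) holomorphic_on ?T"
        using W vW by (intro hol_line[OF f(1)]) (auto intro: csubspaceD)
      then have "\<forall>\<^sub>F t in at 0. f (0 + t \<bullet>\<^sub>c v) \<noteq> 0 \<and> t \<in> ?T"
        by (rule non_zero_neighbour_alt[OF _ T]) (use v in simp)
      then show thesis
        using that by (auto simp: eventually_at)
    qed
    obtain d \<rho>0 where d: "d > 0" "\<rho>0 > 0"
      and line: "\<And>x t. x \<in> W \<Longrightarrow> x \<in> ball 0 d \<Longrightarrow> norm t \<le> \<rho>0 \<Longrightarrow> x + t \<bullet>\<^sub>c v \<in> ?D"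
      using uniform_line_in[OF W Do D0 vW] by blast
    \<comment> \<open>Below \<open>s\<close>, so that \<open>f\<close> has no zero on the circle of
      radius \<rho> over 0; below \<open>\<rho>0\<close>, so that a larger disc over each nearby
      base point still lies in \<open>?D\<close>.\<close>
    define \<rho> where "\<rho> = min (s / 2) (\<rho>0 / 2)"
    have \<rho>: "0 < \<rho>" "\<rho> < \<rho>0" "\<rho> < s"
      using s d by (auto simp: \<rho>_def)
    \<comment> \<open>The circle over 0 is compact, so small translates of it also avoid the zeros
      of \<open>f\<close>.\<close>
    obtain \<epsilon> where \<epsilon>: "\<epsilon> > 0"
      "\<And>p t. p \<in> W \<Longrightarrow> p \<in> ball 0 d \<Longrightarrow> p \<in> ball 0 \<epsilon> \<Longrightarrow> norm t = \<rho> \<Longrightarrow> f (p + t \<bullet>\<^sub>c v) \<noteq> 0"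
    proof -
      have "openin (top_of_set ?D) (?D \<inter> f -` (- {0}))"
        by (rule continuous_openin_preimage_gen[OF holD(1)[OF f(1)]]) auto
      then obtain O' where O': "open O'" "?D \<inter> f -` (- {0}) = ?D \<inter> O'"
        by (auto simp: openin_open)
      let ?K = "(\<lambda>t. t \<bullet>\<^sub>c v) ` sphere 0 \<rho>"
      have "compact ?K"
        by (intro compact_continuous_image continuous_intros) auto
      moreover have "?K \<subseteq> O'"
      proof
        fix y assume "y \<in> ?K"
        then obtain t where t: "norm t = \<rho>" "y = t \<bullet>\<^sub>c v"
          by auto
        then have "y \<in> ?D"
          using line[of 0 t] \<rho> d W by (simp add: csubspaceD)
        moreover have "f y \<noteq> 0"
          unfolding t(2) by (rule s(2)) (use t \<rho> in auto)
        ultimately have "y \<in> ?D \<inter> f -` (- {0})"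
          by auto
        then show "y \<in> O'"
          unfolding O' by blast
      qed
      ultimately obtain \<epsilon> where \<epsilon>: "\<epsilon> > 0" "(\<Union>x\<in>?K. ball x \<epsilon>) \<subseteq> O'"
        using compact_subset_open_imp_ball_epsilon_subset O'(1) by metis
      show thesis
      proof
        fix p and t :: complex assume p: "p \<in> W" "p \<in> ball 0 d" "p \<in> ball 0 \<epsilon>" and t: "norm t = \<rho>"
        have "p + t \<bullet>\<^sub>c v \<in> ball (t \<bullet>\<^sub>c v) \<epsilon>"
          using p by (simp add: dist_norm)
        moreover have "t \<bullet>\<^sub>c v \<in> ?K"
          using t by auto
        ultimately have "p + t \<bullet>\<^sub>c v \<in> O'"
          using \<epsilon>(2) by blast
        moreover have "p + t \<bullet>\<^sub>c v \<in> ?D"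
          using line[of p t] p t \<rho> by auto
        ultimately have "p + t \<bullet>\<^sub>c v \<in> ?D \<inter> f -` (- {0})"
          unfolding O' by blast
        then show "f (p + t \<bullet>\<^sub>c v) \<noteq> 0" by blast
      qed (rule \<epsilon>(1))
    qed
    define r' where "r' = min d \<epsilon>"
    have r': "r' > 0"
      using d \<epsilon> by (simp add: r'_def)
    obtain l where l: "clinear l" "l v = 1"
      using clinear_dual_exists[OF v0] by blast
    note l_simps = clinearD(2-5)[OF l(1)] l(2)
    define W' where "W' = {p \<in> W. l p = 0}"
    have "J p \<in> W" if "p \<in> W" for p
      using csubspaceD(2)[OF W that, of \<i>] by simp
    moreover have "l (J p) = \<i> * l p" for p
      using l(1) by (simp add: clinear_def)
    ultimately have W': "csubspace W'"
      using W linear_scale[OF clinearD(1)[OF l(1)]] unfolding csubspace_def W'_def subspace_def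
      by (auto simp: l_simps)
    have W'W: "W' \<subseteq> W"
      by (auto simp: W'_def)
    let ?D' = "W' \<inter> ball 0 r'"
    have D'o: "openin (top_of_set W') ?D'"
      by (simp add: openin_open_Int)
    have D'c: "connected ?D'"
      by (intro convex_connected convex_Int subspace_imp_convex csubspaceD(1)[OF W'] convex_ball)
    have D'ne: "?D' \<noteq> {}"
      using csubspaceD(5)[OF W'] r' by auto
    have line': "p + t \<bullet>\<^sub>c v \<in> ?D" if "p \<in> ?D'" "norm t < \<rho>0" for p and t :: complex
      using line[of p t] that W'W by (auto simp: r'_def)
    have nz': "f (p + t \<bullet>\<^sub>c v) \<noteq> 0" if "p \<in> ?D'" "norm t = \<rho>" for p and t :: complex
      using \<epsilon>(2)[of p t] that W'W by (auto simp: r'_def)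
    obtain N where N: "\<And>h. hol W ?D h \<Longrightarrow> hol W' ?D' (N h)"
      "\<And>h p. hol W ?D h \<Longrightarrow> p \<in> ?D' \<Longrightarrow>
         N h p = 0 \<longleftrightarrow> (\<exists>t\<in>ball 0 \<rho>. f (p + t \<bullet>\<^sub>c v) = 0 \<and> h (p + t \<bullet>\<^sub>c v) = 0)"
      "\<And>p. p \<in> ?D' \<Longrightarrow> finite {t \<in> ball 0 \<rho>. f (p + t \<bullet>\<^sub>c v) = 0}"
      using hol_fibre_norm[OF W vW f(1) Do W' W'W D'o D'c D'ne \<rho>(1,2) line' nz'] by blast
    \<comment> \<open>\<open>L\<close> is a linear space, so a single zero of \<open>f\<close> kills all of \<open>L\<close> as soon as each member
      of \<open>L\<close> is killed by some zero of \<open>f\<close>.\<close>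
    define L where "L = {h. hol W ?D h \<and> (\<forall>p\<in>?D. (\<forall>g\<in>G. g p = 0) \<longrightarrow> h p = 0)}"
    have L: "hol W ?D h" if "h \<in> L" for h
      using that by (simp add: L_def)
    have "dim W' < dim W"
    proof (rule dim_psubset)
      have "v \<notin> W'"
        using l by (simp add: W'_def)
      then show "span W' \<subset> span W"
        using W'W vW csubspaceD(1)[OF W] csubspaceD(1)[OF W'] by (auto simp: span_eq_iff[THEN iffD2])
    qed
    \<comment> \<open>Projection along \<open>v\<close> onto \<open>W'\<close> leaves
      \<open>z\<close> unchanged because \<open>z v = 0\<close>. The transversal vector and the
      accumulation of zeros off \<open>z = 0\<close> are both carried to \<open>W'\<close> in this
      way.\<close>
    moreover have "e - l e \<bullet>\<^sub>c v \<in> W'"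
      using e(1) vW W by (auto simp: W'_def l_simps intro: csubspaceD)
    moreover have "z (e - l e \<bullet>\<^sub>c v) = 1"
      by (simp add: z_simps v)
    moreover have "hol W' ?D' g" if "g \<in> N ` L" for g
      using that N(1) L by blast
    moreover have "\<exists>p\<in>W' \<inter> ball 0 \<epsilon>'. z p \<noteq> 0 \<and> (\<forall>g\<in>N ` L. g p = 0)" if "\<epsilon>' > 0" for \<epsilon>'
    proof -
      have "isCont l 0"
        using clinearD(6)[OF l(1), of UNIV] by (simp add: continuous_on_eq_continuous_at)
      then have l0: "(l \<longlongrightarrow> 0) (nhds 0)"
        using l_simps(4) by (metis isCont_def tendsto_at_iff_tendsto_nhds)
      then have "((\<lambda>p. p - l p \<bullet>\<^sub>c v) \<longlongrightarrow> 0 - 0 \<bullet>\<^sub>c v) (nhds 0)"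
        by (intro tendsto_intros filterlim_ident)
      then have "\<forall>\<^sub>F p in nhds 0. p - l p \<bullet>\<^sub>c v \<in> ball 0 (min \<epsilon>' r')"
        using that r' by (intro topological_tendstoD) auto
      moreover have "\<forall>\<^sub>F p in nhds 0. l p \<in> ball 0 \<rho>"
        using \<rho> l0 by (intro topological_tendstoD) auto
      moreover have "\<forall>\<^sub>F p in nhds 0. p \<in> ball (0::'v) r"
        using r by (intro eventually_nhds_in_open) auto
      ultimately have "\<forall>\<^sub>F p in nhds 0. p - l p \<bullet>\<^sub>c v \<in> ball 0 (min \<epsilon>' r') \<and> l p \<in> ball 0 \<rho> \<and> p \<in> ball 0 r"
        by eventually_elim auto
      then obtain \<eta> where \<eta>: "\<eta> > 0" "\<And>p. norm p < \<eta> \<Longrightarrow>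
         p - l p \<bullet>\<^sub>c v \<in> ball 0 (min \<epsilon>' r') \<and> l p \<in> ball 0 \<rho> \<and> p \<in> ball 0 r"
        by (auto simp: eventually_nhds_metric)
      obtain p where p: "p \<in> W" "norm p < \<eta>" "z p \<noteq> 0" "\<forall>g\<in>G. g p = 0"
        using acc[OF \<eta>(1)] by auto
      have pD: "p \<in> ?D" and lp: "l p \<in> ball 0 \<rho>"
        using \<eta>(2)[OF p(2)] p by auto
      let ?q = "p - l p \<bullet>\<^sub>c v"
      have qW: "?q \<in> W'"
        using p(1) vW W by (auto simp: W'_def l_simps intro: csubspaceD)
      then have q: "?q \<in> ?D'" "?q \<in> W' \<inter> ball 0 \<epsilon>'"
        using \<eta>(2)[OF p(2)] by auto
      \<comment> \<open>\<open>p\<close> is the point with parameter \<open>l p\<close> over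
        \<open>?q\<close>. It is a zero of \<open>f\<close> because \<open>z p \<noteq> 0\<close>,
        and a zero of \<open>h\<close> because \<open>h \<in> L\<close>.\<close>
      have "N h ?q = 0" if "h \<in> L" for h
        unfolding N(2)[OF L[OF that] q(1)]
        using lp pD p that f_zero[OF pD] by (intro bexI[of _ "l p"]) (auto simp: L_def)
      moreover have "z ?q \<noteq> 0"
        using p by (simp add: z_simps v)
      ultimately show ?thesis
        using q(2) by blast
    qed
    ultimately have "\<exists>\<delta>>0. \<forall>c. norm c < \<delta> \<longrightarrow> (\<exists>p\<in>?D'. z p = c \<and> (\<forall>g\<in>N ` L. g p = 0))"
      by (intro less.hyps[OF _ W' _ _ r'])
    then obtain \<delta> where \<delta>: "\<delta> > 0"
      "\<And>c. norm c < \<delta> \<Longrightarrow> \<exists>p\<in>?D'. z p = c \<and> (\<forall>g\<in>N ` L. g p = 0)"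
      by blast
    have "\<exists>p\<in>?D. z p = c \<and> (\<forall>g\<in>G. g p = 0)" if "norm c < \<delta>" for c
    proof -
      obtain q where q: "q \<in> ?D'" "z q = c" "\<forall>h\<in>L. N h q = 0"
        using \<delta>(2)[OF \<open>norm c < \<delta>\<close>] by auto
      let ?Z = "{t \<in> ball 0 \<rho>. f (q + t \<bullet>\<^sub>c v) = 0}"
      let ?L = "(\<lambda>h t. h (q + t \<bullet>\<^sub>c v)) ` L"
      have "\<exists>t\<in>?Z. \<forall>g\<in>?L. g t = 0"
      proof (rule common_zero_if_combinations_vanish)
        show "finite ?Z" by (rule N(3)[OF q(1)])
        have "(\<lambda>_. 0) \<in> L" by (simp add: L_def)
        then show "?L \<noteq> {}" by blast
        show "(\<lambda>t. g t + c * h t) \<in> ?L" if gh_in: "g \<in> ?L" "h \<in> ?L" for g h c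
        proof -
          obtain g' h' where gh: "g' \<in> L" "h' \<in> L" "g = (\<lambda>t. g' (q + t \<bullet>\<^sub>c v))" "h = (\<lambda>t. h' (q + t \<bullet>\<^sub>c v))"
            using gh_in by blast
          have "(\<lambda>p. g' p + c * h' p) \<in> L"
            using gh(1,2) by (auto simp: L_def intro!: hol_add hol_mult)
          then show ?thesis
            unfolding gh(3,4) by (rule rev_image_eqI) (rule refl)
        qed
        show "\<exists>t\<in>?Z. h t = 0" if "h \<in> ?L" for h
        proof -
          obtain h' where h': "h' \<in> L" "h = (\<lambda>t. h' (q + t \<bullet>\<^sub>c v))"
            using \<open>h \<in> ?L\<close> by (rule imageE)
          then have "N h' q = 0"
            using q(3) by blast
          then show ?thesis
            unfolding N(2)[OF L[OF h'(1)] q(1)] h'(2) by blast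
        qed
      qed
      then obtain t where t: "norm t < \<rho>" "\<forall>h\<in>L. h (q + t \<bullet>\<^sub>c v) = 0"
        by auto
      have "G \<subseteq> L"
        using G by (auto simp: L_def)
      then have "\<forall>g\<in>G. g (q + t \<bullet>\<^sub>c v) = 0"
        using t(2) by blast
      moreover have "q + t \<bullet>\<^sub>c v \<in> ?D"
        using line'[OF q(1), of t] t(1) \<rho> by simp
      moreover have "z (q + t \<bullet>\<^sub>c v) = c"
        by (simp add: z_simps v q)
      ultimately show ?thesis
        by blast
    qed
    then show ?thesis
      using \<delta>(1) by blast
  qed
qed

end

section \<open>Inverses in a finite-dimensional algebra\<close>

text \<open>The Euclidean norm need not be submultiplicative; a constant \<open>K\<close> obtained
  from finite dimension takes its place in the estimates below.\<close>

lemma bounded_bilinear_algebra_mult: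
  "bounded_bilinear ((*) :: 'a::{real_algebra_1, euclidean_space} \<Rightarrow> 'a \<Rightarrow> 'a)"
proof -
  have "bilinear ((*) :: 'a \<Rightarrow> 'a \<Rightarrow> 'a)"
    unfolding bilinear_def by (auto intro!: linearI simp: algebra_simps)
  then show ?thesis
    by (simp add: bilinear_conv_bounded_bilinear)
qed

lemmas continuous_on_algebra_mult =
  bounded_bilinear.continuous_on[OF bounded_bilinear_algebra_mult]

lemmas tendsto_algebra_mult = bounded_bilinear.tendsto[OF bounded_bilinear_algebra_mult]

lemmas has_derivative_algebra_mult = bounded_bilinear.FDERIV[OF bounded_bilinear_algebra_mult]

definition is_unit_alg :: "'a::monoid_mult \<Rightarrow> bool" where
  "is_unit_alg m \<longleftrightarrow> (\<exists>n. m * n = 1 \<and> n * m = 1)"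

definition inv_alg :: "'a::monoid_mult \<Rightarrow> 'a" where
  "inv_alg m = (SOME n. m * n = 1 \<and> n * m = 1)"

lemma inv_alg:
  assumes "is_unit_alg m"
  shows "m * inv_alg m = 1" "inv_alg m * m = 1" "m * (inv_alg m * x) = x" "inv_alg m * (m * x) = x"
proof -
  show "m * inv_alg m = 1" "inv_alg m * m = 1"
    using someI_ex[OF assms[unfolded is_unit_alg_def]] unfolding inv_alg_def by auto
  then show "m * (inv_alg m * x) = x" "inv_alg m * (m * x) = x"
    by (simp_all add: mult.assoc[symmetric])
qed

lemma is_unit_algI: "m * n = 1 \<Longrightarrow> n * m = 1 \<Longrightarrow> is_unit_alg m"
  by (auto simp: is_unit_alg_def)

lemma is_unit_alg_1: "is_unit_alg 1"
  by (rule is_unit_algI[of _ 1]) auto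

lemma is_unit_alg_mult:
  assumes "is_unit_alg a" "is_unit_alg b"
  shows "is_unit_alg (a * b)"
  by (rule is_unit_algI[of _ "inv_alg b * inv_alg a"]) (simp_all add: mult.assoc inv_alg assms)

text \<open>If \<open>m * x = 0\<close>, then \<open>x = - ((m - 1) * x)\<close> would be shorter
  than itself unless it is 0. In finite dimension, injective left multiplication is surjective,
  which gives a right inverse \<open>n\<close>; cancelling \<open>m\<close> in
  \<open>m * (n * m - 1) = 0\<close> makes it two-sided.\<close>

lemma is_unit_alg_near_1:
  obtains e where "e > 0" "\<And>m :: 'a::{real_algebra_1, euclidean_space}. norm (m - 1) < e \<Longrightarrow> is_unit_alg m"
proof -
  obtain K where K: "K > 0" "\<And>x y :: 'a. norm (x * y) \<le> norm x * norm y * K"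
    using bounded_bilinear.pos_bounded[OF bounded_bilinear_algebra_mult] by blast
  show thesis
  proof
    show "1 / K > 0" using K by simp
    fix m :: 'a assume m: "norm (m - 1) < 1 / K"
    have lin: "linear ((*) m)"
      by (rule linearI) (simp_all add: algebra_simps)
    have "x = 0" if "m * x = 0" for x
    proof (rule ccontr)
      assume "x \<noteq> 0"
      have "x = - ((m - 1) * x)"
        using that by (simp add: algebra_simps)
      then have "norm x \<le> norm (m - 1) * norm x * K"
        using K(2)[of "m - 1" x] by (metis norm_minus_cancel)
      moreover have "norm (m - 1) * norm x * K < 1 / K * norm x * K"
        using m K(1) \<open>x \<noteq> 0\<close> by (intro mult_strict_right_mono) auto
      ultimately show False
        using K(1) by simp
    qed
    note zero = this
    then have "inj ((*) m)"
      using lin linear_injective_0 by blast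
    then have "surj ((*) m)"
      using lin linear_injective_imp_surjective by blast
    then obtain n where n: "m * n = 1"
      by (metis surjD)
    have "m * (n * m - 1) = 0"
      by (simp add: right_diff_distrib mult.assoc[symmetric] n)
    then have "n * m = 1"
      using zero by fastforce
    then show "is_unit_alg m"
      using n by (rule is_unit_algI[rotated])
  qed
qed

lemma open_units_alg: "open {m :: 'a::{real_algebra_1, euclidean_space}. is_unit_alg m}"
proof (subst open_subopen, rule ballI)
  fix m0 :: 'a assume "m0 \<in> {m. is_unit_alg m}"
  then have u: "is_unit_alg m0" by simp
  obtain e where e: "e > 0" "\<And>m :: 'a. norm (m - 1) < e \<Longrightarrow> is_unit_alg m"
    using is_unit_alg_near_1 by blast
  have "open ((\<lambda>m. inv_alg m0 * m) -` ball 1 e)"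
    by (intro open_vimage continuous_on_algebra_mult continuous_intros) auto
  moreover have "m0 \<in> (\<lambda>m. inv_alg m0 * m) -` ball 1 e"
    using e u by (simp add: inv_alg)
  moreover have "(\<lambda>m. inv_alg m0 * m) -` ball 1 e \<subseteq> {m. is_unit_alg m}"
  proof
    fix m assume "m \<in> (\<lambda>m. inv_alg m0 * m) -` ball 1 e"
    then have "is_unit_alg (inv_alg m0 * m)"
      using e(2)[of "inv_alg m0 * m"] by (simp add: dist_norm norm_minus_commute)
    then have "is_unit_alg (m0 * (inv_alg m0 * m))"
      by (rule is_unit_alg_mult[OF u])
    then show "m \<in> {m. is_unit_alg m}"
      using u by (simp add: inv_alg)
  qed
  ultimately show "\<exists>T. open T \<and> m0 \<in> T \<and> T \<subseteq> {m. is_unit_alg m}"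
    by blast
qed

lemma inv_alg_diff:
  fixes m :: "'a::ring_1"
  assumes "is_unit_alg m" "is_unit_alg m0"
  shows "inv_alg m - inv_alg m0 = - (inv_alg m * (m - m0) * inv_alg m0)"
  using assms by (simp add: algebra_simps inv_alg)

text \<open>\<open>inv_alg_diff\<close> bounds the difference by a multiple of
  \<open>norm (inv_alg m)\<close> itself. Once the factor is below 1/2 this term is absorbed, giving
  \<open>norm (inv_alg m) \<le> 2 * norm (inv_alg m0)\<close> near \<open>m0\<close>.\<close>

lemma isCont_inv_alg:
  fixes m0 :: "'a::{real_algebra_1, euclidean_space}"
  assumes u: "is_unit_alg m0"
  shows "(inv_alg \<longlongrightarrow> inv_alg m0) (at m0)"
proof -
  let ?N = "inv_alg :: 'a \<Rightarrow> 'a"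
  obtain K where K: "K > 0" "\<And>x y :: 'a. norm (x * y) \<le> norm x * norm y * K"
    using bounded_bilinear.pos_bounded[OF bounded_bilinear_algebra_mult] by blast
  define B where "B = K * K * norm (?N m0)"
  have B: "B \<ge> 0" using K by (simp add: B_def)
  have bound: "norm (?N m - ?N m0) \<le> norm (?N m) * (norm (m - m0) * B)" if "is_unit_alg m" for m
  proof -
    have "norm (?N m - ?N m0) = norm (?N m * (m - m0) * ?N m0)"
      by (simp add: inv_alg_diff[OF that u])
    also have "\<dots> \<le> norm (?N m * (m - m0)) * norm (?N m0) * K"
      by (rule K)
    also have "\<dots> \<le> (norm (?N m) * norm (m - m0) * K) * norm (?N m0) * K"
      using K by (intro mult_right_mono K(2)) auto
    finally show ?thesis
      by (simp add: B_def mult_ac)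
  qed
  have ev_unit: "\<forall>\<^sub>F m in at m0. is_unit_alg m"
    using eventually_nhds_in_open[OF open_units_alg, of m0] u by (simp add: eventually_at_filter eventually_mono)
  have lim0: "((\<lambda>m. norm (m - m0) * B) \<longlongrightarrow> norm (m0 - m0) * B) (at m0)"
    by (intro tendsto_intros)
  then have "\<forall>\<^sub>F m in at m0. norm (m - m0) * B < 1 / 2"
    by (rule order_tendstoD) simp
  with ev_unit have "\<forall>\<^sub>F m in at m0. norm (?N m - ?N m0) \<le> 2 * norm (?N m0) * (norm (m - m0) * B)"
  proof eventually_elim
    case (elim m)
    have "norm (?N m) \<le> norm (?N m0) + norm (?N m - ?N m0)"
      by (metis norm_triangle_sub)
    also have "\<dots> \<le> norm (?N m0) + norm (?N m) * (1 / 2)"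
      using bound[OF elim(1)] mult_left_mono[OF less_imp_le[OF elim(2)], of "norm (?N m)"] by simp
    finally have "norm (?N m) \<le> 2 * norm (?N m0)"
      by simp
    then show ?case
      using bound[OF elim(1)] B by (meson mult_nonneg_nonneg mult_right_mono norm_ge_zero order_trans)
  qed
  moreover have "((\<lambda>m. 2 * norm (?N m0) * (norm (m - m0) * B)) \<longlongrightarrow> 0) (at m0)"
    using tendsto_mult_right_zero[of _ _ "2 * norm (?N m0)"] lim0 by simp
  ultimately have "((\<lambda>m. ?N m - ?N m0) \<longlongrightarrow> 0) (at m0)"
    by (rule Lim_null_comparison)
  then show ?thesis
    by (rule LIM_zero_cancel)
qed

text \<open>Inserting \<open>inv_alg_diff\<close> leaves the remainder
  \<open>- ((inv_alg m - inv_alg m0) * (m - m0) * inv_alg m0)\<close>, so continuity of the inverse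
  suffices.\<close>

lemma has_derivative_inv_alg:
  fixes m0 :: "'a::{real_algebra_1, euclidean_space}"
  assumes u: "is_unit_alg m0"
  shows "(inv_alg has_derivative (\<lambda>h. - (inv_alg m0 * h * inv_alg m0))) (at m0)"
proof -
  let ?N = "inv_alg :: 'a \<Rightarrow> 'a"
  obtain K where K: "K > 0" "\<And>x y :: 'a. norm (x * y) \<le> norm x * norm y * K"
    using bounded_bilinear.pos_bounded[OF bounded_bilinear_algebra_mult] by blast
  have "linear (\<lambda>h. - (?N m0 * h * ?N m0))"
    by (rule linearI) (simp_all add: algebra_simps)
  moreover have "\<forall>\<^sub>F m in at m0. norm (norm (?N m - ?N m0 - - (?N m0 * (m - m0) * ?N m0)) / norm (m - m0))
      \<le> norm (?N m - ?N m0) * (K * norm (?N m0) * K)"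
  proof -
    have "\<forall>\<^sub>F m in at m0. is_unit_alg m \<and> m \<noteq> m0"
      using eventually_nhds_in_open[OF open_units_alg, of m0] u by (simp add: eventually_at_filter eventually_mono)
    then show ?thesis
    proof eventually_elim
      case (elim m)
      have "?N m - ?N m0 - - (?N m0 * (m - m0) * ?N m0) = - ((?N m - ?N m0) * (m - m0) * ?N m0)"
        using elim u by (simp add: algebra_simps inv_alg mult_2)
      then have "norm (?N m - ?N m0 - - (?N m0 * (m - m0) * ?N m0)) = norm ((?N m - ?N m0) * (m - m0) * ?N m0)"
        by (metis norm_minus_cancel)
      also have "\<dots> \<le> norm ((?N m - ?N m0) * (m - m0)) * norm (?N m0) * K"
        by (rule K)
      also have "\<dots> \<le> (norm (?N m - ?N m0) * norm (m - m0) * K) * norm (?N m0) * K"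
        using K by (intro mult_right_mono K(2)) auto
      finally show ?case
        using elim by (simp add: divide_le_eq mult_ac)
    qed
  qed
  moreover have "((\<lambda>m. norm (?N m - ?N m0) * (K * norm (?N m0) * K)) \<longlongrightarrow> 0) (at m0)"
    using tendsto_mult_left_zero[OF tendsto_norm_zero[OF LIM_zero[OF isCont_inv_alg[OF u]]]] .
  ultimately show ?thesis
    unfolding has_derivative_iff_norm
    by (auto intro: Lim_null_comparison simp: linear_conv_bounded_linear)
qed

context complex_structure
begin

lemma holI_has_derivative:
  assumes "\<And>p. p \<in> D \<Longrightarrow> \<exists>E. (f has_derivative E) (at p) \<and> (\<forall>q. E (J q) = \<i> * E q)"
  shows "hol W D f"
  unfolding hol_def
proof (intro conjI ballI)
  show "continuous_on D f"
    using assms by (meson continuous_at_imp_continuous_on has_derivative_continuous)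
  fix p q assume "p \<in> D"
  then obtain E where E: "(f has_derivative E) (at p)" "\<And>q. E (J q) = \<i> * E q"
    using assms by blast
  have lin: "linear E"
    using E(1) by (simp add: has_derivative_linear)
  have "((\<lambda>t. p + t \<bullet>\<^sub>c q) has_derivative (\<lambda>t. t \<bullet>\<^sub>c q)) (at 0)"
    by (rule has_derivative_eq_rhs, rule has_derivative_add[OF has_derivative_const
          bounded_linear.has_derivative[OF bounded_bilinear.bounded_linear_left[OF bounded_bilinear_cscale]
            has_derivative_ident]]) simp
  then have "((\<lambda>t. f (p + t \<bullet>\<^sub>c q)) has_derivative (\<lambda>t. E (t \<bullet>\<^sub>c q))) (at 0)"
    by (rule has_derivative_compose[where g = f]) (simp add: E(1))
  moreover have "E (t \<bullet>\<^sub>c q) = E q * t" for t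
    by (simp add: cscale_def linear_add[OF lin] linear_scale[OF lin] E(2) complex_eq_iff)
  ultimately have "((\<lambda>t. f (p + t \<bullet>\<^sub>c q)) has_field_derivative E q) (at 0)"
    by (simp add: has_field_derivative_def)
  then show "(\<lambda>t. f (p + t \<bullet>\<^sub>c q)) field_differentiable at 0"
    by (auto simp: field_differentiable_def)
qed

end

section \<open>Cayley charts of the imaginary units\<close>

text \<open>
  \<open>cayley s0\<close> maps the tangent space of the units at \<open>s0\<close>, with complex structure \<open>h \<mapsto> s0 * h\<close>,
  biholomorphically near \<open>0\<close> onto a neighbourhood of \<open>s0\<close>.  It is holomorphic and takes values
  in the units on the whole algebra, so the tangent space need not be singled out.
\<close>

definition cayley :: "'a::{real_algebra_1, euclidean_space} \<Rightarrow> 'a \<Rightarrow> 'a" where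
  "cayley s0 x = inv_alg (1 - x) * (s0 * (1 - x))"

definition pair_i :: "'a::{real_algebra_1, euclidean_space} \<Rightarrow> complex \<times> 'a \<Rightarrow> complex \<times> 'a" where
  "pair_i s0 p = (\<i> * fst p, s0 * snd p)"

definition cayley_chart ::
    "complex \<Rightarrow> 'a::{real_algebra_1, euclidean_space} \<Rightarrow> complex \<times> 'a \<Rightarrow> complex \<times> 'a" where
  "cayley_chart z0 s0 p = (z0 + fst p, cayley s0 (snd p))"

lemma units_sphereD:
  assumes "s \<in> units_sphere"
  shows "s * s = - 1" "s * (s * x) = - x"
proof -
  show "s * s = - 1"
    using assms by (simp add: units_sphere_def power2_eq_square)
  then show "s * (s * x) = - x"
    by (simp add: mult.assoc[symmetric])
qed

text \<open>This is the value of \<open>s + s0\<close> at \<open>s = s0\<close>. By openness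
  \<open>s + s0\<close> is invertible near \<open>s0\<close>, as needed both for inverting the chart
  and for trivialising the bundle.\<close>

lemma is_unit_alg_double:
  fixes s :: "'a::{real_algebra_1, euclidean_space}"
  assumes "s \<in> units_sphere"
  shows "is_unit_alg (s + s)"
proof (rule is_unit_algI)
  have half: "(1 / 2) *\<^sub>R 1 + (1 / 2) *\<^sub>R 1 = (1 :: 'a)"
    by (metis field_sum_of_halves scaleR_left_distrib scaleR_one)
  then have half': "(1 / 2) *\<^sub>R (2 :: 'a) = 1"
    by (simp only: scaleR_add_right[symmetric] one_add_one)
  show "(s + s) * ((- 1 / 2) *\<^sub>R s) = 1" "((- 1 / 2) *\<^sub>R s) * (s + s) = 1"
    by (simp_all add: distrib_left distrib_right units_sphereD[OF assms] half half')
qed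

lemma complex_structure_pair_i: "s0 \<in> units_sphere \<Longrightarrow> complex_structure (pair_i s0)"
  by unfold_locales
    (auto intro!: linearI simp: pair_i_def units_sphereD algebra_simps mult.assoc[symmetric])

lemma cayley_0 [simp]: "cayley s0 0 = s0"
  for s0 :: "'a::{real_algebra_1, euclidean_space}"
  using inv_alg(2)[OF is_unit_alg_1[where 'a = 'a]] by (simp add: cayley_def)

lemma cayley_in_units_sphere:
  assumes "s0 \<in> units_sphere" "is_unit_alg (1 - x)"
  shows "cayley s0 x \<in> units_sphere"
proof -
  define m where "m = 1 - x"
  have m: "is_unit_alg m"
    using assms(2) by (simp add: m_def)
  show ?thesis
    unfolding cayley_def m_def[symmetric]
    by (simp add: units_sphere_def power2_eq_square mult.assoc inv_alg[OF m] units_sphereD[OF assms(1)])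
qed

lemma has_derivative_cayley:
  assumes u: "is_unit_alg (1 - x)"
  shows "(cayley s0 has_derivative
    (\<lambda>k. inv_alg (1 - x) * (k * cayley s0 x) - inv_alg (1 - x) * (s0 * k))) (at x)"
proof -
  have 1: "((\<lambda>x. 1 - x) has_derivative (\<lambda>k. - k)) (at x)"
    by (auto intro!: derivative_eq_intros)
  have "((\<lambda>x. inv_alg (1 - x)) has_derivative (\<lambda>k. - (inv_alg (1 - x) * (- k) * inv_alg (1 - x)))) (at x)"
    by (rule has_derivative_compose[OF 1 has_derivative_inv_alg[OF u]])
  note has_derivative_algebra_mult[OF this has_derivative_algebra_mult[OF has_derivative_const 1], of s0]
  then show ?thesis
    unfolding cayley_def[abs_def]
    by (rule has_derivative_eq_rhs) (simp add: cayley_def mult.assoc fun_eq_iff)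
qed

text \<open>Both parts rest on the intertwining
  \<open>cayley s0 x * inv_alg (1 - x) = inv_alg (1 - x) * s0\<close>. The second says that the
  derivative takes values in the tangent space at \<open>cayley s0 x\<close>, the only vectors on
  which a \<open>holomorphic_map\<close> is constrained.\<close>

lemma cayley_derivative_complex_linear:
  fixes s0 x :: "'a::{real_algebra_1, euclidean_space}"
  assumes s0: "s0 \<in> units_sphere" and u: "is_unit_alg (1 - x)"
  defines "D \<equiv> \<lambda>k. inv_alg (1 - x) * (k * cayley s0 x) - inv_alg (1 - x) * (s0 * k)"
  shows "D (s0 * k) = cayley s0 x * D k" "cayley s0 x * D k + D k * cayley s0 x = 0"
proof -
  let ?p = "inv_alg (1 - x)" and ?s = "cayley s0 x"
  have sp: "?s * (?p * y) = ?p * (s0 * y)" for y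
    by (simp add: cayley_def mult.assoc inv_alg u)
  have ss: "?s * ?s = - 1"
    using cayley_in_units_sphere[OF s0 u] by (rule units_sphereD)
  show "D (s0 * k) = ?s * D k"
    by (simp add: D_def right_diff_distrib sp units_sphereD[OF s0] mult.assoc)
  show "?s * D k + D k * ?s = 0"
    by (simp add: D_def right_diff_distrib left_diff_distrib sp units_sphereD[OF s0] mult.assoc ss)
qed

text \<open>For \<open>x\<close> anticommuting with \<open>s0\<close>, the equation
  \<open>(1 - x) * s = s0 * (1 - x)\<close> becomes \<open>x * (s + s0) = s - s0\<close>, whence the
  formula for \<open>x\<close>. That this \<open>x\<close> does anticommute with \<open>s0\<close>
  follows from \<open>(s + s0) * s = s0 * (s + s0)\<close> and its mirror image.\<close>

lemma cayley_surj:
  assumes s0: "s0 \<in> units_sphere" and s: "s \<in> units_sphere" and u: "is_unit_alg (s + s0)"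
    and ux: "is_unit_alg (1 - (s - s0) * inv_alg (s + s0))"
  shows "cayley s0 ((s - s0) * inv_alg (s + s0)) = s"
proof -
  define n where "n = inv_alg (s + s0)"
  define x where "x = (s - s0) * n"
  have "(s + s0) * s = s0 * (s + s0)"
    by (simp add: algebra_simps units_sphereD s s0)
  then have "n * ((s + s0) * s) * n = n * (s0 * (s + s0)) * n"
    by simp
  then have sn: "s * n = n * s0"
    using u by (simp add: n_def mult.assoc inv_alg)
  have "s * (s + s0) = (s + s0) * s0"
    by (simp add: algebra_simps units_sphereD s s0)
  then have "n * (s * (s + s0)) * n = n * ((s + s0) * s0) * n"
    by simp
  then have ns: "n * s = s0 * n"
    using u by (simp add: n_def mult.assoc inv_alg)
  have x1: "x * (s + s0) = s - s0"
    using u by (simp add: x_def n_def mult.assoc inv_alg)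
  have "s0 * x = s0 * (s - s0) * n"
    by (simp add: x_def mult.assoc)
  also have "s0 * (s - s0) = - ((s - s0) * s)"
    by (simp add: algebra_simps units_sphereD s s0)
  finally have x2: "s0 * x = - (x * s0)"
    by (simp add: x_def mult.assoc sn)
  have "(1 - x) * s = s0 * (1 - x)"
    using x1 x2 by (simp add: algebra_simps)
  then have "cayley s0 x = inv_alg (1 - x) * ((1 - x) * s)"
    by (simp add: cayley_def)
  also have "\<dots> = s"
    using ux by (simp add: inv_alg x_def n_def)
  finally show ?thesis
    by (simp add: x_def n_def)
qed

lemma eventually_unit_one_minus:
  "\<forall>\<^sub>F x in nhds (0 :: 'a::{real_algebra_1, euclidean_space}). is_unit_alg (1 - x)"
proof -
  have "open ((\<lambda>x :: 'a. 1 - x) -` {m. is_unit_alg m})"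
    by (intro open_vimage open_units_alg continuous_intros)
  then show ?thesis
    using eventually_nhds_in_open[of "(\<lambda>x :: 'a. 1 - x) -` {m. is_unit_alg m}" 0]
    by (simp add: is_unit_alg_1)
qed

lemma has_derivative_cayley_chart:
  assumes u: "is_unit_alg (1 - snd p)"
  shows "(cayley_chart z0 s0 has_derivative (\<lambda>q. (fst q,
    inv_alg (1 - snd p) * (snd q * cayley s0 (snd p)) - inv_alg (1 - snd p) * (s0 * snd q)))) (at p)"
proof -
  have "((\<lambda>p. z0 + fst p) has_derivative fst) (at p)"
    by (auto intro!: derivative_eq_intros)
  moreover have "((\<lambda>p. cayley s0 (snd p)) has_derivative
      (\<lambda>q. inv_alg (1 - snd p) * (snd q * cayley s0 (snd p)) - inv_alg (1 - snd p) * (s0 * snd q))) (at p)"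
    by (rule has_derivative_compose[OF has_derivative_snd[OF has_derivative_ident] has_derivative_cayley[OF u]])
  ultimately show ?thesis
    unfolding cayley_chart_def[abs_def] by (rule has_derivative_Pair)
qed

lemma cayley_chart_in:
  fixes s0 :: "'a::{real_algebra_1, euclidean_space}"
  assumes s0: "s0 \<in> units_sphere" and U: "open U"
    and V: "openin (top_of_set (U \<times> units_sphere)) V" "(z0, s0) \<in> V"
  obtains r where "r > 0"
    "\<And>p. p \<in> ball 0 r \<Longrightarrow> is_unit_alg (1 - snd p) \<and> cayley_chart z0 s0 p \<in> V"
proof -
  obtain O' where O': "open O'" "V = (U \<times> units_sphere) \<inter> O'"
    using V(1) by (auto simp: openin_open)
  have "(cayley_chart z0 s0 \<longlongrightarrow> cayley_chart z0 s0 0) (at 0)"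
    using has_derivative_continuous[OF has_derivative_cayley_chart[of 0 z0 s0]] is_unit_alg_1
    by (simp add: continuous_at)
  then have lim: "(cayley_chart z0 s0 \<longlongrightarrow> (z0, s0)) (nhds 0)"
    using tendsto_at_iff_tendsto_nhds[of "cayley_chart z0 s0" 0] by (simp add: cayley_chart_def)
  have "\<forall>\<^sub>F p in nhds 0. cayley_chart z0 s0 p \<in> O' \<inter> (U \<times> UNIV)"
    using O' V(2) U by (intro topological_tendstoD[OF lim]) (auto intro!: open_Int open_Times)
  moreover have "\<forall>\<^sub>F p :: complex \<times> 'a in nhds 0. is_unit_alg (1 - snd p)"
  proof -
    have "open ((\<lambda>p :: complex \<times> 'a. 1 - snd p) -` {m. is_unit_alg m})"
      by (intro open_vimage open_units_alg continuous_intros)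
    then show ?thesis
      using eventually_nhds_in_open[of "(\<lambda>p :: complex \<times> 'a. 1 - snd p) -` {m. is_unit_alg m}" 0]
      by (simp add: is_unit_alg_1)
  qed
  ultimately have "\<forall>\<^sub>F p in nhds 0. is_unit_alg (1 - snd p) \<and> cayley_chart z0 s0 p \<in> V"
    by eventually_elim (auto simp: O'(2) cayley_chart_def cayley_in_units_sphere s0)
  then obtain r where "r > 0" "\<And>p. dist p 0 < r \<Longrightarrow> is_unit_alg (1 - snd p) \<and> cayley_chart z0 s0 p \<in> V"
    unfolding eventually_nhds_metric by blast
  then show thesis
    by (intro that[of r]) (auto simp: dist_commute)
qed

text \<open>The derivative of \<phi> exists only within \<open>V\<close>, but \<open>B\<close> is
  open in the full space, so the composite has an ordinary derivative. It is complex linear in all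
  directions because the chart sends each of them to a tangent vector.\<close>

lemma hol_cayley_chart:
  fixes s0 :: "'a::{real_algebra_1, euclidean_space}"
  assumes s0: "s0 \<in> units_sphere"
    and \<phi>: "holomorphic_map (plane_domain U \<times>\<^sub>c sphere_cmanifold) (plane_domain UNIV) V \<phi>"
    and B: "open B" "\<And>p. p \<in> B \<Longrightarrow> is_unit_alg (1 - snd p) \<and> cayley_chart z0 s0 p \<in> V"
  shows "complex_structure.hol (pair_i s0) UNIV B (\<lambda>p. \<phi> (cayley_chart z0 s0 p))"
proof -
  interpret complex_structure "pair_i s0"
    by (rule complex_structure_pair_i[OF s0])
  show ?thesis
  proof (rule holI_has_derivative)
    fix p assume p: "p \<in> B"
    let ?s = "cayley s0 (snd p)"
    define E where "E q = (fst q,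
      inv_alg (1 - snd p) * (snd q * ?s) - inv_alg (1 - snd p) * (s0 * snd q))" for q :: "complex \<times> 'a"
    have u: "is_unit_alg (1 - snd p)" and pV: "cayley_chart z0 s0 p \<in> V"
      using B(2)[OF p] by auto
    have E: "(cayley_chart z0 s0 has_derivative E) (at p within B)"
      using has_derivative_cayley_chart[OF u, of z0 s0] unfolding E_def[abs_def] by (rule has_derivative_at_withinI)
    obtain D where D: "(\<phi> has_derivative D) (at (cayley_chart z0 s0 p) within V)"
      "\<And>\<zeta> h. ?s * h + h * ?s = 0 \<Longrightarrow> D (\<i> * \<zeta>, ?s * h) = \<i> * D (\<zeta>, h)"
      using \<phi> pV unfolding holomorphic_map_def
      by (fastforce simp: plane_domain_def prod_cmanifold_def sphere_cmanifold_def cayley_chart_def)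
    have "((\<lambda>p. \<phi> (cayley_chart z0 s0 p)) has_derivative (\<lambda>q. D (E q))) (at p within B)"
      using B(2) by (intro has_derivative_in_compose[OF E] has_derivative_subset[OF D(1)]) auto
    then have "((\<lambda>p. \<phi> (cayley_chart z0 s0 p)) has_derivative (\<lambda>q. D (E q))) (at p)"
      by (simp only: at_within_open[OF p B(1)])
    moreover have "D (E (pair_i s0 q)) = \<i> * D (E q)" for q
    proof -
      note lin = cayley_derivative_complex_linear[OF s0 u, of "snd q"]
      have "E (pair_i s0 q) = (\<i> * fst q, ?s * snd (E q))"
        using lin(1) by (simp add: E_def pair_i_def)
      moreover have "D (\<i> * fst q, ?s * snd (E q)) = \<i> * D (fst q, snd (E q))"
        using lin(2) by (intro D(2)) (simp add: E_def)
      ultimately show ?thesis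
        by (simp add: E_def)
    qed
    ultimately show "\<exists>E. ((\<lambda>p. \<phi> (cayley_chart z0 s0 p)) has_derivative E) (at p) \<and>
        (\<forall>q. E (pair_i s0 q) = \<i> * E q)"
      by (intro exI[of _ "\<lambda>q. D (E q)"]) auto
  qed
qed

section \<open>The zero locus\<close>

lemma analytic_subsetE:
  assumes "analytic_subset M X Z" "p \<in> X"
  obtains V G where "openin (top_of_set (points M)) V" "p \<in> V"
    "\<And>g. g \<in> G \<Longrightarrow> holomorphic_map M (plane_domain UNIV) V g"
    "Z \<inter> V = {q \<in> X \<inter> V. \<forall>g\<in>G. g q = 0}"
  using assms unfolding analytic_subset_def by meson

lemma analytic_zero_locus:
  fixes K :: "'a::{real_algebra_1, euclidean_space} set"
  assumes K: "K \<subseteq> units_sphere" and U: "open U" and F: "holomorphic_map (plane_domain U) cplx_cmanifold U F"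
  shows "analytic_subset (plane_domain U \<times>\<^sub>c sphere_cmanifold) (U \<times> K) (zero_locus U F K)"
    (is "analytic_subset ?M _ _")
proof -
  have pts: "points ?M = U \<times> units_sphere"
    by (simp add: prod_cmanifold_def plane_domain_def sphere_cmanifold_def)
  have "\<exists>V G. openin (top_of_set (points ?M)) V \<and> (z0, s0) \<in> V \<and> finite G \<and>
      (\<forall>g\<in>G. holomorphic_map ?M (plane_domain UNIV) V g) \<and>
      zero_locus U F K \<inter> V = {q \<in> U \<times> K \<inter> V. \<forall>g\<in>G. g q = 0}" if z0: "z0 \<in> U" and s0K: "s0 \<in> K" for z0 s0
  proof -
    have s0: "s0 \<in> units_sphere"
      using s0K K by blast
    define V where "V = (U \<times> units_sphere) \<inter> {q :: complex \<times> 'a. is_unit_alg (snd q + s0)}"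
    define l where "l b x = complex_of_real (x \<bullet> b) - \<i> * complex_of_real ((s0 * x) \<bullet> b)" for b x :: 'a
    \<comment> \<open>Multiplication by the inverse of \<open>s + s0\<close> turns left multiplication by \<open>s\<close> into left
      multiplication by \<open>s0\<close>: a holomorphic trivialisation of the bundle of complex vector
      spaces \<open>('a, s)\<close>.  The \<open>l b\<close> are complex coordinates on \<open>('a, s0)\<close>.\<close>
    define h where "h q = inv_alg (snd q + s0) * slice_val (F (fst q)) (snd q)" for q
    have "open ((\<lambda>q :: complex \<times> 'a. snd q + s0) -` {m. is_unit_alg m})"
      by (intro open_vimage open_units_alg continuous_intros)
    then have V: "openin (top_of_set (points ?M)) V"
      by (auto simp: V_def pts vimage_def intro!: openin_open_Int)
    have z0V: "(z0, s0) \<in> V"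
      using z0 s0 is_unit_alg_double[OF s0] by (simp add: V_def)
    have l_lin: "bounded_linear (l b)" for b
      unfolding l_def
      by (intro bounded_linear_sub bounded_linear_const_mult bounded_linear_compose[OF bounded_linear_of_real]
          bounded_linear_inner_left_comp bounded_bilinear.bounded_linear_right[OF bounded_bilinear_algebra_mult]
          bounded_linear_inner_left bounded_linear_ident)
    have l_i: "l b (s0 * x) = \<i> * l b x" for b x
      by (simp add: l_def units_sphereD[OF s0] complex_eq_iff)
    have l_0: "x = 0" if "\<forall>b\<in>Basis. l b x = 0" for x
    proof (rule euclidean_eqI)
      fix b :: 'a assume "b \<in> Basis"
      then have "l b x = 0" using that by blast
      then show "x \<bullet> b = 0 \<bullet> b"
        by (simp add: l_def complex_eq_iff)
    qed
    have "holomorphic_map ?M (plane_domain UNIV) V (\<lambda>q. l b (h q))" for b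
      unfolding holomorphic_map_def
    proof (intro conjI ballI)
      show "openin (top_of_set (points ?M)) V" by (rule V)
      show "(\<lambda>q. l b (h q)) ` V \<subseteq> points (plane_domain UNIV)"
        by (simp add: plane_domain_def)
      fix q assume q: "q \<in> V"
      obtain z s where zs: "q = (z, s)" "z \<in> U" "s \<in> units_sphere" "is_unit_alg (s + s0)"
        using q by (auto simp: V_def)
      obtain DF where DF: "(F has_derivative DF) (at z within U)" "\<And>\<zeta>. DF (\<i> * \<zeta>) = cplx_i (DF \<zeta>)"
        using F zs(2) unfolding holomorphic_map_def
        by (fastforce simp: plane_domain_def cplx_cmanifold_def)
      let ?n = "inv_alg (s + s0)"
      have dfst: "(fst has_derivative fst) (at q within V)"
        by (rule has_derivative_fst[OF has_derivative_ident])
      have dsnd: "(snd has_derivative snd) (at q within V)"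
        by (rule has_derivative_snd[OF has_derivative_ident])
      have dF: "((\<lambda>q. F (fst q)) has_derivative (\<lambda>d. DF (fst d))) (at q within V)"
        by (rule has_derivative_in_compose[OF dfst has_derivative_subset[of F DF _ U]])
          (use DF(1) zs(1) in \<open>auto simp: V_def\<close>)
      have dval: "((\<lambda>q. slice_val (F (fst q)) (snd q)) has_derivative
          (\<lambda>d. fst (DF (fst d)) + (s * snd (DF (fst d)) + snd d * snd (F z)))) (at q within V)"
        unfolding slice_val_def
        using has_derivative_add[OF has_derivative_fst[OF dF] has_derivative_algebra_mult[OF dsnd has_derivative_snd[OF dF]]]
        by (simp add: zs(1))
      have "((\<lambda>q :: complex \<times> 'a. snd q + s0) has_derivative snd) (at q within V)"
        using has_derivative_add[OF dsnd has_derivative_const[of s0]] by simp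
      then have dinv: "((\<lambda>q :: complex \<times> 'a. inv_alg (snd q + s0)) has_derivative (\<lambda>d. - (?n * snd d * ?n))) (at q within V)"
        by (rule has_derivative_compose) (use has_derivative_inv_alg[OF zs(4)] zs(1) in simp)
      define E where "E d = ?n * (fst (DF (fst d)) + (s * snd (DF (fst d)) + snd d * snd (F z)))
          + - (?n * snd d * ?n) * slice_val (F z) s" for d
      have "(h has_derivative E) (at q within V)"
        using has_derivative_algebra_mult[OF dinv dval] unfolding h_def[abs_def] E_def[abs_def]
        by (simp add: zs(1))
      then have "((\<lambda>q. l b (h q)) has_derivative (\<lambda>d. l b (E d))) (at q within V)"
        by (rule bounded_linear.has_derivative[OF l_lin])
      moreover have "l b (E (cstr ?M q d)) = cstr (plane_domain UNIV) (l b (h q)) (l b (E d))" for d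
      proof -
        have "?n * ((s + s0) * (s0 * ?n)) = ?n * (s * ((s + s0) * ?n))"
          by (simp add: algebra_simps units_sphereD zs(3) s0)
        then have ns: "?n * s = s0 * ?n"
          by (simp add: inv_alg[OF zs(4)])
        have nsx: "?n * (s * x) = s0 * (?n * x)" for x
          by (simp add: mult.assoc[symmetric] ns)
        have "E (\<i> * fst d, s * snd d) = s0 * E d"
          by (simp add: E_def DF(2) cplx_i_def distrib_left right_diff_distrib mult.assoc nsx units_sphereD[OF s0])
        then show ?thesis
          by (simp add: zs(1) prod_cmanifold_def plane_domain_def sphere_cmanifold_def split_def l_i)
      qed
      ultimately show "\<exists>D. ((\<lambda>q. l b (h q)) has_derivative D) (at q within V) \<and>
          (\<forall>d\<in>tangent ?M q. D (cstr ?M q d) = cstr (plane_domain UNIV) (l b (h q)) (D d))"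
        by blast
    qed
    moreover have "zero_locus U F K \<inter> V = {q \<in> U \<times> K \<inter> V. \<forall>g\<in>(\<lambda>b q. l b (h q)) ` Basis. g q = 0}"
    proof -
      have "slice_val (F z) s = 0 \<longleftrightarrow> (\<forall>b\<in>Basis. l b (h (z, s)) = 0)" if "(z, s) \<in> V" for z s
      proof -
        have u: "is_unit_alg (s + s0)"
          using that by (simp add: V_def)
        have "slice_val (F z) s = 0 \<longleftrightarrow> h (z, s) = 0"
          using inv_alg(3)[OF u, of "slice_val (F z) s"] by (auto simp: h_def)
        also have "\<dots> \<longleftrightarrow> (\<forall>b\<in>Basis. l b (h (z, s)) = 0)"
          using l_0 by (auto simp: l_def)
        finally show ?thesis .
      qed
      then show ?thesis
        by (auto simp: zero_locus_def)
    qed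
    ultimately show ?thesis
      using V z0V by (intro exI[of _ V] exI[of _ "(\<lambda>b q. l b (h q)) ` Basis"]) auto
  qed
  moreover have "zero_locus U F K \<subseteq> U \<times> K"
    by (auto simp: zero_locus_def)
  moreover have "U \<times> K \<subseteq> points ?M"
    using K by (auto simp: pts)
  ultimately show ?thesis
    unfolding analytic_subset_def by fastforce
qed

section \<open>The projection of the zero locus to \<open>U\<close>\<close>

lemma continuous_on_slice_val:
  fixes F :: "complex \<Rightarrow> 'a::{real_algebra_1, euclidean_space} cplx"
  assumes "continuous_on U F"
  shows "continuous_on (U \<times> S) (\<lambda>q. slice_val (F (fst q)) (snd q))"
  unfolding slice_val_def
  by (intro continuous_on_algebra_mult continuous_intros continuous_on_compose2[OF assms]) auto

lemma zero_locus_projection_open: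
  fixes K :: "'a::{real_algebra_1, euclidean_space} set"
  assumes Kan: "analytic_subset sphere_cmanifold units_sphere K" and U: "open U"
    and F: "holomorphic_map (plane_domain U) cplx_cmanifold U F"
    and z0: "z0 \<in> U" and s0: "s0 \<in> K"
    and acc: "\<And>\<epsilon>. \<epsilon> > 0 \<Longrightarrow> \<exists>z s. (z, s) \<in> zero_locus U F K \<and> z \<noteq> z0 \<and> dist z z0 < \<epsilon> \<and> dist s s0 < \<epsilon>"
  shows "\<exists>\<delta>>0. ball z0 \<delta> \<subseteq> fst ` zero_locus U F K"
proof -
  let ?M = "plane_domain U \<times>\<^sub>c sphere_cmanifold :: (complex \<times> 'a) cmanifold"
  let ?C = "zero_locus U F K"
  have pts: "points ?M = U \<times> units_sphere" "points (sphere_cmanifold :: 'a cmanifold) = units_sphere"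
    by (simp_all add: prod_cmanifold_def plane_domain_def sphere_cmanifold_def)
  have KS: "K \<subseteq> units_sphere"
    using Kan by (simp add: analytic_subset_def)
  then have s0S: "s0 \<in> units_sphere"
    using s0 by blast
  obtain V1 G1 where V1: "openin (top_of_set (U \<times> units_sphere)) V1" "(z0, s0) \<in> V1"
    and G1: "\<And>g. g \<in> G1 \<Longrightarrow> holomorphic_map ?M (plane_domain UNIV) V1 g"
    and C: "?C \<inter> V1 = {q \<in> U \<times> K \<inter> V1. \<forall>g\<in>G1. g q = 0}"
    by (rule analytic_subsetE[OF analytic_zero_locus[OF KS U F] SigmaI[OF z0 s0], unfolded pts]) (rule that)
  obtain V2 G2 where V2: "openin (top_of_set units_sphere) V2" "s0 \<in> V2"
    and G2: "\<And>g. g \<in> G2 \<Longrightarrow> holomorphic_map sphere_cmanifold (plane_domain UNIV) V2 g"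
    and K: "K \<inter> V2 = {q \<in> units_sphere \<inter> V2. \<forall>g\<in>G2. g q = 0}"
    by (rule analytic_subsetE[OF Kan s0S, unfolded pts]) (rule that)
  have UV2: "openin (top_of_set (U \<times> units_sphere)) (U \<times> V2)"
    using V2(1) by (intro openin_Times) auto
  have G2': "holomorphic_map ?M (plane_domain UNIV) (U \<times> V2) (\<lambda>q. g (snd q))" if g: "g \<in> G2" for g
    unfolding holomorphic_map_def
  proof (intro conjI ballI)
    show "openin (top_of_set (points ?M)) (U \<times> V2)"
      using UV2 by (simp add: pts)
    show "(\<lambda>q. g (snd q)) ` (U \<times> V2) \<subseteq> points (plane_domain UNIV)"
      by (simp add: plane_domain_def)
    fix q assume q: "q \<in> U \<times> V2"
    then obtain D where D: "(g has_derivative D) (at (snd q) within V2)"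
      "\<And>h. snd q * h + h * snd q = 0 \<Longrightarrow> D (snd q * h) = \<i> * D h"
      using G2[OF g] unfolding holomorphic_map_def
      by (fastforce simp: plane_domain_def sphere_cmanifold_def)
    have "((\<lambda>q. g (snd q)) has_derivative (\<lambda>d. D (snd d))) (at q within U \<times> V2)"
      by (rule has_derivative_in_compose[OF has_derivative_snd[OF has_derivative_ident] has_derivative_subset[OF D(1)]])
        (use q in auto)
    moreover have "D (snd (cstr ?M q d)) = cstr (plane_domain UNIV) (g (snd q)) (D (snd d))"
      if "d \<in> tangent ?M q" for d
      using that D(2) by (auto simp: prod_cmanifold_def plane_domain_def sphere_cmanifold_def split_def)
    ultimately show "\<exists>D. ((\<lambda>q. g (snd q)) has_derivative D) (at q within U \<times> V2) \<and>
        (\<forall>d\<in>tangent ?M q. D (cstr ?M q d) = cstr (plane_domain UNIV) (g (snd q)) (D d))"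
      by blast
  qed
  let ?\<Gamma> = "cayley_chart z0 s0"
  obtain r1 where r1: "r1 > 0" "\<And>p. p \<in> ball 0 r1 \<Longrightarrow> is_unit_alg (1 - snd p) \<and> ?\<Gamma> p \<in> V1"
    using cayley_chart_in[OF s0S U V1] by blast
  obtain r2 where r2: "r2 > 0" "\<And>p. p \<in> ball 0 r2 \<Longrightarrow> is_unit_alg (1 - snd p) \<and> ?\<Gamma> p \<in> U \<times> V2"
    using cayley_chart_in[OF s0S U UV2, of z0] z0 V2(2) by blast
  define r where "r = min r1 r2"
  have r: "r > 0" "ball 0 r \<subseteq> ball (0 :: complex \<times> 'a) r1" "ball 0 r \<subseteq> ball (0 :: complex \<times> 'a) r2"
    using r1 r2 by (auto simp: r_def)
  \<comment> \<open>\<open>G1\<close> cuts out the zero locus only within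
    \<open>U \<times> K\<close>; the equations \<open>G2\<close> of \<open>K\<close>, made
    independent of \<open>z\<close>, supply the rest.\<close>
  define G where "G = (\<lambda>g p. g (?\<Gamma> p)) ` G1 \<union> (\<lambda>g p. g (snd (?\<Gamma> p))) ` G2"
  have G_zero: "(\<forall>g\<in>G. g p = 0) \<longleftrightarrow> ?\<Gamma> p \<in> ?C" if "p \<in> ball 0 r" for p
  proof -
    have V: "?\<Gamma> p \<in> V1" "?\<Gamma> p \<in> U \<times> V2"
      using that r r1(2)[of p] r2(2)[of p] by blast+
    then have "?\<Gamma> p \<in> U \<times> (units_sphere \<inter> V2)"
      using openin_imp_subset[OF V2(1)] by auto
    then have "(\<forall>g\<in>G2. g (snd (?\<Gamma> p)) = 0) \<longleftrightarrow> ?\<Gamma> p \<in> U \<times> K"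
      using eqset_imp_iff[OF K, of "snd (?\<Gamma> p)"] by (simp add: mem_Times_iff)
    moreover have "?\<Gamma> p \<in> ?C \<longleftrightarrow> ?\<Gamma> p \<in> U \<times> K \<and> (\<forall>g\<in>G1. g (?\<Gamma> p) = 0)"
      using V(1) eqset_imp_iff[OF C, of "?\<Gamma> p"] by simp
    ultimately show ?thesis
      by (auto simp: G_def)
  qed
  interpret complex_structure "pair_i s0"
    by (rule complex_structure_pair_i[OF s0S])
  have "\<exists>\<delta>>0. \<forall>c. norm c < \<delta> \<longrightarrow> (\<exists>p\<in>UNIV \<inter> ball 0 r. fst p = c \<and> (\<forall>g\<in>G. g p = 0))"
  proof (rule hol_zeros_project)
    show "csubspace UNIV"
      by (simp add: csubspace_def)
    show "clinear fst"
      by (simp add: clinear_def linear_fst pair_i_def)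
    show "(1, 0) \<in> UNIV" "fst (1, 0) = 1"
      by simp_all
    show "hol UNIV (UNIV \<inter> ball 0 r) g" if "g \<in> G" for g
      using that r r1(2) r2(2) unfolding G_def Int_UNIV_left
      by (auto intro!: hol_cayley_chart[OF s0S] G1 hol_cayley_chart[OF s0S G2'])
    show "\<exists>p\<in>UNIV \<inter> ball 0 \<epsilon>. fst p \<noteq> 0 \<and> (\<forall>g\<in>G. g p = 0)" if "\<epsilon> > 0" for \<epsilon>
    proof -
      define \<epsilon>' where "\<epsilon>' = min \<epsilon> r"
      have \<epsilon>': "\<epsilon>' > 0" using that r by (simp add: \<epsilon>'_def)
      \<comment> \<open>The inverse of the Cayley chart near \<open>s0\<close>. It tends to 0 at
        \<open>s0\<close>, so zeros near \<open>(z0, s0)\<close> become common zeros of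
        \<open>G\<close> near the origin.\<close>
      define x where "x s = (s - s0) * inv_alg (s + s0)" for s
      note u0 = is_unit_alg_double[OF s0S]
      have sum: "((\<lambda>s. s + s0) \<longlongrightarrow> s0 + s0) (nhds s0)"
        by (intro tendsto_intros filterlim_ident)
      have "(inv_alg \<longlongrightarrow> inv_alg (s0 + s0)) (nhds (s0 + s0))"
        using isCont_inv_alg[OF u0] by (simp add: tendsto_at_iff_tendsto_nhds)
      then have "((\<lambda>s. inv_alg (s + s0)) \<longlongrightarrow> inv_alg (s0 + s0)) (nhds s0)"
        by (rule filterlim_compose[OF _ sum])
      then have "(x \<longlongrightarrow> (s0 - s0) * inv_alg (s0 + s0)) (nhds s0)"
        unfolding x_def by (intro tendsto_algebra_mult tendsto_intros filterlim_ident)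
      then have xlim: "(x \<longlongrightarrow> 0) (nhds s0)" by simp
      have "\<forall>\<^sub>F s in nhds s0. is_unit_alg (s + s0)"
        using topological_tendstoD[OF sum open_units_alg] u0 by simp
      moreover have "\<forall>\<^sub>F s in nhds s0. is_unit_alg (1 - x s)"
        by (rule eventually_compose_filterlim[OF eventually_unit_one_minus xlim])
      moreover have "\<forall>\<^sub>F s in nhds s0. dist (x s) 0 < \<epsilon>' / 2"
        using \<epsilon>' by (intro tendstoD[OF xlim]) auto
      ultimately have "\<forall>\<^sub>F s in nhds s0. is_unit_alg (s + s0) \<and> is_unit_alg (1 - x s) \<and> norm (x s) < \<epsilon>' / 2"
        by eventually_elim auto
      then obtain d where d: "d > 0" "\<And>s. dist s s0 < d \<Longrightarrow>
          is_unit_alg (s + s0) \<and> is_unit_alg (1 - x s) \<and> norm (x s) < \<epsilon>' / 2"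
        unfolding eventually_nhds_metric by blast
      obtain z s where zs: "(z, s) \<in> ?C" "z \<noteq> z0" "dist z z0 < min d (\<epsilon>' / 2)" "dist s s0 < min d (\<epsilon>' / 2)"
        using acc[of "min d (\<epsilon>' / 2)"] d \<epsilon>' by auto
      have sS: "s \<in> units_sphere"
        using zs(1) KS by (auto simp: zero_locus_def)
      have u: "is_unit_alg (s + s0)" "is_unit_alg (1 - x s)" "norm (x s) < \<epsilon>' / 2"
        using d(2)[of s] zs(4) by auto
      let ?p = "(z - z0, x s)"
      have "norm ?p \<le> norm (z - z0) + norm (x s)"
        by (rule norm_Pair_le)
      also have "\<dots> < \<epsilon>'"
        using zs(3) u(3) by (simp add: dist_norm)
      finally have "?p \<in> ball 0 \<epsilon>" "?p \<in> ball 0 r"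
        by (simp_all add: \<epsilon>'_def)
      moreover have "?\<Gamma> ?p = (z, s)"
        using cayley_surj[OF s0S sS u(1)] u(2) by (simp add: cayley_chart_def x_def)
      ultimately show ?thesis
        using G_zero[of ?p] zs(1,2) by (intro bexI[of _ ?p]) auto
    qed
  qed (rule r(1))
  then obtain \<delta> where \<delta>: "\<delta> > 0"
    "\<And>c. norm c < \<delta> \<Longrightarrow> \<exists>p\<in>ball 0 r. fst p = c \<and> (\<forall>g\<in>G. g p = 0)"
    by auto
  have "z \<in> fst ` ?C" if z: "z \<in> ball z0 \<delta>" for z
  proof -
    have "norm (z - z0) < \<delta>"
      using z by (simp add: dist_norm norm_minus_commute)
    from \<delta>(2)[OF this] obtain p where p: "p \<in> ball 0 r" "fst p = z - z0" "\<forall>g\<in>G. g p = 0"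
      by blast
    then have "?\<Gamma> p \<in> ?C"
      using G_zero by blast
    moreover have "fst (?\<Gamma> p) = z"
      using p(2) by (simp add: cayley_chart_def)
    ultimately show ?thesis
      by force
  qed
  then show ?thesis
    using \<delta>(1) by blast
qed

text \<open>At a limit point of \<open>Z\<close> a whole ball lies in \<open>Z\<close>, and the
  empty set of equations describes it. At any other point \<open>z\<close> some neighbourhood meets
  \<open>Z\<close> at most in \<open>z\<close>, and the equation is \<open>w - z\<close> or the
  constant 1. Closedness of \<open>Z\<close> in \<open>U\<close> is contained in the hypothesis on
  limit points.\<close>

lemma analytic_subset_plane_domainI:
  assumes U: "open U" and Z: "Z \<subseteq> U"
    and acc: "\<And>z. z \<in> U \<Longrightarrow> z islimpt Z \<Longrightarrow> \<exists>\<delta>>0. ball z \<delta> \<subseteq> Z"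
  shows "analytic_subset (plane_domain U) U Z"
proof -
  have hm: "holomorphic_map (plane_domain U) (plane_domain UNIV) V g"
    if V: "open V" "V \<subseteq> U" and g: "g holomorphic_on V" for V g
    unfolding holomorphic_map_def
  proof (intro conjI ballI)
    show "openin (top_of_set (points (plane_domain U))) V"
      using V U by (auto simp: plane_domain_def openin_open_eq)
    show "g ` V \<subseteq> points (plane_domain UNIV)"
      by (simp add: plane_domain_def)
    fix p assume "p \<in> V"
    then obtain d where "(g has_field_derivative d) (at p within V)"
      using g by (auto simp: holomorphic_on_def field_differentiable_def)
    then show "\<exists>D. (g has_derivative D) (at p within V) \<and>
        (\<forall>h\<in>tangent (plane_domain U) p. D (cstr (plane_domain U) p h) = cstr (plane_domain UNIV) (g p) (D h))"
      by (intro exI[of _ "(*) d"] conjI ballI)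
        (simp_all only: plane_domain_def cmanifold.simps has_field_derivative_def mult.left_commute)
  qed
  have "\<exists>V G. openin (top_of_set U) V \<and> z \<in> V \<and> finite G \<and>
      (\<forall>g\<in>G. holomorphic_map (plane_domain U) (plane_domain UNIV) V g) \<and>
      Z \<inter> V = {q \<in> U \<inter> V. \<forall>g\<in>G. g q = 0}" if z: "z \<in> U" for z
  proof (cases "z islimpt Z")
    case True
    then obtain \<delta> where "\<delta> > 0" "ball z \<delta> \<subseteq> Z"
      using acc z by blast
    then show ?thesis
      using Z U by (intro exI[of _ "ball z \<delta>"] exI[of _ "{}"]) (auto simp: openin_open_eq)
  next
    case False
    then obtain T where T: "z \<in> T" "open T" "\<And>y. y \<in> Z \<Longrightarrow> y \<in> T \<Longrightarrow> y = z"
      unfolding islimpt_def by blast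
    let ?g = "if z \<in> Z then (\<lambda>w. w - z) else (\<lambda>_. 1)"
    have "holomorphic_map (plane_domain U) (plane_domain UNIV) (T \<inter> U) ?g"
      using T(2) U by (intro hm) (auto intro!: holomorphic_intros)
    moreover have "Z \<inter> (T \<inter> U) = {q \<in> U \<inter> (T \<inter> U). ?g q = 0}"
    proof (cases "z \<in> Z")
      case True
      then have "Z \<inter> (T \<inter> U) = {z}"
        using T Z by blast
      then show ?thesis
        using True T(1) z by auto
    next
      case False
      then have "Z \<inter> (T \<inter> U) = {}"
        using T(3) by blast
      then show ?thesis
        using False by simp
    qed
    moreover have "openin (top_of_set U) (T \<inter> U)"
      using T(2) U by (simp add: openin_open_eq open_Int)
    ultimately show ?thesis
      using z T(1) by (intro exI[of _ "T \<inter> U"] exI[of _ "{?g}"]) simp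
  qed
  then show ?thesis
    using Z unfolding analytic_subset_def by (simp add: plane_domain_def)
qed

text \<open>Choose zeros over a sequence of image points tending to \<open>z0\<close>; compactness
  of \<open>K\<close> yields a subsequence whose second components converge in
  \<open>K\<close>.\<close>

lemma zero_locus_accumulation:
  assumes "compact K" and lim: "z0 islimpt fst ` zero_locus U F K"
  obtains s0 where "s0 \<in> K"
    "\<And>\<epsilon>. \<epsilon> > 0 \<Longrightarrow> \<exists>z s. (z, s) \<in> zero_locus U F K \<and> z \<noteq> z0 \<and> dist z z0 < \<epsilon> \<and> dist s s0 < \<epsilon>"
proof -
  obtain f where f: "\<And>n :: nat. f n \<in> fst ` zero_locus U F K - {z0}" "f \<longlonglongrightarrow> z0"
    using lim unfolding islimpt_sequential by blast
  then have "\<forall>n. \<exists>s. (f n, s) \<in> zero_locus U F K"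
    by fastforce
  then obtain s where s: "\<And>n. (f n, s n) \<in> zero_locus U F K"
    by metis
  then have "\<forall>n. s n \<in> K"
    by (auto simp: zero_locus_def)
  then obtain s0 r where s0: "s0 \<in> K" and r: "strict_mono r" "(s \<circ> r) \<longlonglongrightarrow> s0"
    using \<open>compact K\<close> unfolding compact_def by metis
  have "\<exists>z t. (z, t) \<in> zero_locus U F K \<and> z \<noteq> z0 \<and> dist z z0 < \<epsilon> \<and> dist t s0 < \<epsilon>" if "\<epsilon> > 0" for \<epsilon>
  proof -
    have "\<forall>\<^sub>F n in sequentially. dist ((f \<circ> r) n) z0 < \<epsilon> \<and> dist ((s \<circ> r) n) s0 < \<epsilon>"
      using tendstoD[OF LIMSEQ_subseq_LIMSEQ[OF f(2) r(1)] that] tendstoD[OF r(2) that]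
      by (rule eventually_conj)
    then obtain n where "dist (f (r n)) z0 < \<epsilon>" "dist (s (r n)) s0 < \<epsilon>"
      unfolding eventually_sequentially by auto
    then show ?thesis
      using s[of "r n"] f(1)[of "r n"] by blast
  qed
  with s0 show thesis ..
qed

text \<open>Projection along a compact factor is a closed map, and it stays closed on a closed
  subset, whose fibres are closed in copies of \<open>K\<close>.\<close>

lemma proper_map_fst_closedin:
  assumes K: "compact K" and C: "closedin (top_of_set (U \<times> K)) C"
  shows "proper_map (top_of_set C) (top_of_set U) fst"
  unfolding proper_map_def
proof (intro conjI ballI)
  have prod: "prod_topology (top_of_set U) (top_of_set K) = top_of_set (U \<times> K)"
    by (simp add: subtopology_Times)
  have cl: "closed_map (top_of_set (U \<times> K)) (top_of_set U) fst"
    using closed_map_fst[of "top_of_set K" "top_of_set U"] K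
    by (simp add: prod compact_space_subtopology)
  show "closed_map (top_of_set C) (top_of_set U) fst"
    unfolding closed_map_def
  proof (intro allI impI)
    fix S assume "closedin (top_of_set C) S"
    then have "closedin (top_of_set (U \<times> K)) S"
      using C by (rule closedin_trans)
    then show "closedin (top_of_set U) (fst ` S)"
      using cl unfolding closed_map_def by blast
  qed
  fix z assume "z \<in> topspace (top_of_set U)"
  then have "{z} \<times> K \<subseteq> U \<times> K"
    by auto
  moreover obtain T where T: "closed T" "C = U \<times> K \<inter> T"
    using C unfolding closedin_closed by blast
  ultimately have "{z} \<times> K \<inter> C = {z} \<times> K \<inter> T"
    by blast
  then have "compact ({z} \<times> K \<inter> C)"
    using K T(1) by (simp add: compact_Int_closed compact_Times)
  moreover have "{x \<in> topspace (top_of_set C). fst x = z} = {z} \<times> K \<inter> C"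
    using closedin_imp_subset[OF C] by auto
  ultimately show "compactin (top_of_set C) {x \<in> topspace (top_of_set C). fst x = z}"
    by (simp add: compactin_subtopology)
qed

lemma closedin_zero_locus:
  fixes F :: "complex \<Rightarrow> 'a::{real_algebra_1, euclidean_space} cplx"
  assumes "continuous_on U F"
  shows "closedin (top_of_set (U \<times> K)) (zero_locus U F K)"
proof -
  have "zero_locus U F K = (U \<times> K) \<inter> (\<lambda>q. slice_val (F (fst q)) (snd q)) -` {0}"
    by (auto simp: zero_locus_def)
  then show ?thesis
    using continuous_closedin_preimage[OF continuous_on_slice_val[OF assms], of "{0}" K] by simp
qed

theorem theorem3p4:
  fixes K :: "'a::{real_algebra_1, euclidean_space} set"
    and U :: "complex set"
    and F :: "complex \<Rightarrow> 'a cplx"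
    and f :: "'a \<Rightarrow> 'a"
  assumes "compact K"
    and "analytic_subset sphere_cmanifold units_sphere K"
    and "open U"
    and "cnj ` U = U"
    and "holomorphic_stem U F"
    and "slice_induced U F f"
  shows "analytic_subset (plane_domain U \<times>\<^sub>c sphere_cmanifold) (U \<times> K) (zero_locus U F K)
    \<and> (proper_map (top_of_set (zero_locus U F K)) (top_of_set U) fst
       \<and> fst ` zero_locus U F K = {z \<in> U. F z \<in> zero_cone K}
       \<and> analytic_subset (plane_domain U) U {z \<in> U. F z \<in> zero_cone K})
    \<and> (case_prod slice_pt ` zero_locus U F K \<subseteq> case_prod slice_pt ` (U \<times> K)
       \<and> case_prod slice_pt ` zero_locus U F K = {x \<in> case_prod slice_pt ` (U \<times> K). f x = 0})"
proof -
  have K: "K \<subseteq> units_sphere"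
    using assms(2) by (simp add: analytic_subset_def)
  have F: "holomorphic_map (plane_domain U) cplx_cmanifold U F"
    using assms(5) by (simp add: holomorphic_stem_def)
  have "continuous_on U F"
    unfolding continuous_on_eq_continuous_within
    using F by (meson has_derivative_continuous holomorphic_map_def)
  then have "proper_map (top_of_set (zero_locus U F K)) (top_of_set U) fst"
    by (intro proper_map_fst_closedin[OF assms(1)] closedin_zero_locus)
  moreover have img: "fst ` zero_locus U F K = {z \<in> U. F z \<in> zero_cone K}"
    by (force simp: zero_locus_def zero_cone_def)
  moreover have "analytic_subset (plane_domain U) U (fst ` zero_locus U F K)"
  proof (rule analytic_subset_plane_domainI[OF assms(3)])
    show "fst ` zero_locus U F K \<subseteq> U"
      by (auto simp: zero_locus_def)
    fix z assume z: "z \<in> U" and lim: "z islimpt fst ` zero_locus U F K"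
    obtain s where "s \<in> K" "\<And>\<epsilon>. \<epsilon> > 0 \<Longrightarrow>
        \<exists>w t. (w, t) \<in> zero_locus U F K \<and> w \<noteq> z \<and> dist w z < \<epsilon> \<and> dist t s < \<epsilon>"
      using zero_locus_accumulation[OF assms(1) lim] by blast
    then show "\<exists>\<delta>>0. ball z \<delta> \<subseteq> fst ` zero_locus U F K"
      by (rule zero_locus_projection_open[OF assms(2,3) F z])
  qed
  moreover have "case_prod slice_pt ` zero_locus U F K \<subseteq> case_prod slice_pt ` (U \<times> K)"
    by (auto simp: zero_locus_def)
  moreover have "case_prod slice_pt ` zero_locus U F K = {x \<in> case_prod slice_pt ` (U \<times> K). f x = 0}"
  proof -
    \<comment> \<open>\<open>f\<close> is prescribed through every representation of a point as
      \<open>slice_pt z s\<close>. So a zero of \<open>f\<close> may be tested on a representation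
      with \<open>s \<in> K\<close>, whatever other representations the point has.\<close>
    have f: "f (slice_pt z s) = slice_val (F z) s" if "z \<in> U" "s \<in> K" for z s
      using assms(6) K that by (auto simp: slice_induced_def)
    show ?thesis
    proof (intro equalityI subsetI)
      fix x assume "x \<in> case_prod slice_pt ` zero_locus U F K"
      then obtain z s where "z \<in> U" "s \<in> K" "slice_val (F z) s = 0" "x = slice_pt z s"
        by (auto simp: zero_locus_def)
      then show "x \<in> {x \<in> case_prod slice_pt ` (U \<times> K). f x = 0}"
        using f by auto
    next
      fix x assume "x \<in> {x \<in> case_prod slice_pt ` (U \<times> K). f x = 0}"
      then obtain z s where zs: "z \<in> U" "s \<in> K" "f (slice_pt z s) = 0" "x = slice_pt z s"
        by auto
      then have "(z, s) \<in> zero_locus U F K"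
        using f[OF zs(1,2)] by (simp add: zero_locus_def)
      then show "x \<in> case_prod slice_pt ` zero_locus U F K"
        using zs(4) by force
    qed
  qed
  ultimately show ?thesis
    using analytic_zero_locus[OF K assms(3) F] by (simp only: img)
qed

end
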